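(* Let $\mathbf A$ be either $\begin{pmatrix}1&1\\1&0\end{pmatrix}$ or $\begin{pmatrix}0&1\\1&1\end{pmatrix}$, and let $\mathcal{C}=L_2(\Sigma_{\mathbf A}^+;\mathbb{R})$ be the set of real-valued 2-locally constant functions on $\Sigma_{\mathbf A}^+$. Then $$\{f\in\mathcal{C}:[f]_3=[f]_1\}=\mathcal{C}.$$
   Context: Let $N\ge 2$ and $\mathbf A$ an $N\times N$ aperiodic zero-one matrix (some power has all entries positive); here $N=2$. $\Sigma_{\mathbf A}^+=\{\omega=(\omega_n)_{n\ge 0}\in\{1,\dots,N\}^{\mathbb{N}\cup\{0\}}:\mathbf A_{\omega_n\omega_{n+1}}=1 \text{ for all } n\ge 0\}$, with metric $d(\omega,\omega')=\sum_{n\ge0}|\omega_n-\omega'_n|/2^n$; $\sigma_{\mathbf A}$ is the shift $(\sigma_{\mathbf A}\omega)_n=\omega_{n+1}$. A function $\phi$ on $\Sigma_{\mathbf A}^+$ is $n$-locally constant if $\phi(\omega)=\phi(\omega')$ whenever $\omega_k=\omega'_k$ for $0\le k\le n-1$. Cylinders: $C_n(\omega)=\{\omega'\in\Sigma_{\mathbf A}^+:\omega'_k=\omega_k,\ 0\le k\le n-1\}$, $C_0(\omega)=\Sigma_{\mathbf A}^+$. Gibbs measures: a $\sigma_{\mathbf A}$-invariant Borel probability measure $\mu$ is a Gibbs measure for continuous $f:\Sigma_{\mathbf A}^+\to\mathbb{R}$ if there are $C>0$, $P\in\mathbb{R}$ with $C^{-1}\le \mu(C_n(\omega))/\exp(-nP+\sum_{k=0}^{n-1}f(\sigma_{\mathbf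 A}^k\omega))\le C$ for all $\omega$ and $n\ge1$. Each Hölder continuous real $f$ (in particular each locally constant one) has a unique Gibbs measure $\mu_f$. Entropy spectrum: $E_\alpha^{(\mu)}=\{\omega:\lim_{n\to\infty}-\frac1n\log\mu(C_n(\omega))=\alpha\}$ and $\mathcal{E}^{(\mu)}(\alpha)=h(\sigma_{\mathbf A}|E_\alpha^{(\mu)})$ for $\alpha\in\mathbb{R}$. Here $h(\sigma_{\mathbf A}|Z)$ is Bowen's topological entropy of a subset $Z$: the infimum of all $s\ge0$ such that $\lim_{n\to\infty}\inf\sum_i e^{-s n_i}=0$, the infimum over countable covers of $Z$ by cylinders $C_{n_i}(\omega^{(i)})$ with all $n_i\ge n$; $h(\sigma_{\mathbf A}|\emptyset)=0$. Isomorphic: $(\Sigma_{\mathbf A}^+,\sigma_{\mathbf A},\mu_f)$ and $(\Sigma_{\mathbf A}^+,\sigma_{\mathbf A},\mu_g)$ are isomorphic if there exist Borel sets $X,Y\subset\Sigma_{\mathbf A}^+$ and a bijection $\Phi:X\to Y$ with $\sigma_{\mathbf A}(X)\subset X$, $\sigma_{\mathbf A}(Y)\subset Y$, $\mu_f(X)=\mu_g(Y)=1$; $\Phi,\Phi^{-1}$ Borel measurable; $\Phi\circ\sigma_{\mathbf A}=\sigma_{\mathbf A}\circ\Phi$ on $X$; $\mu_f=\mu_g\circ\Phi$ (i.e. $\mu_f(B)=\mu_g(\Phi(B))$ for Borel $B\subset X$). Classes: for $f\in\mathcal{C}$, $[f]_1=\{g\in\mathcal{C}:\mathcal{E}^{(\mu_f)}=\mathcal{E}^{(\mu_g)}\}$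 and $[f]_3=\{g\in\mathcal{C}:(\Sigma_{\mathbf A}^+,\sigma_{\mathbf A},\mu_f)\text{ and }(\Sigma_{\mathbf A}^+,\sigma_{\mathbf A},\mu_g)\text{ are isomorphic}\}$. *)

theory Defs
  imports
    "HOL-Probability.Probability"
    "Jordan_Normal_Form.Matrix"
begin

text \<open>
  The symbols are \<open>1, \<dots>, N\<close> with \<open>N = dim_row A\<close>, whereas matrix entries are
  addressed from \<open>0\<close>; hence the index shift by one.
\<close>

definition markov_shift :: "nat mat \<Rightarrow> (nat \<Rightarrow> nat) set" where
  "markov_shift A =
     {\<omega>. \<forall>n. \<omega> n \<in> {1..dim_row A} \<and> A $$ (\<omega> n - 1, \<omega> (Suc n) - 1) = 1}"

definition shift_map :: "(nat \<Rightarrow> nat) \<Rightarrow> nat \<Rightarrow> nat" where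
  "shift_map \<omega> = (\<lambda>n. \<omega> (Suc n))"

text \<open>
  The set-indexed sum has value \<open>0\<close> when the terms are not summable (which only happens outside
  of the shift space); this makes the distance nonnegative everywhere, as required by
  \<^locale>\<open>Metric_space\<close>.
\<close>

definition seq_dist :: "(nat \<Rightarrow> nat) \<Rightarrow> (nat \<Rightarrow> nat) \<Rightarrow> real" where
  "seq_dist \<omega> \<omega>' = (\<Sum>\<^sub>\<infinity>n. \<bar>real (\<omega> n) - real (\<omega>' n)\<bar> / 2 ^ n)"

lemma seq_dist_summable:
  assumes "\<omega> \<in> markov_shift A" "\<omega>' \<in> markov_shift A"
  shows "(\<lambda>n. \<bar>real (\<omega> n) - real (\<omega>' n)\<bar> / 2 ^ n) summable_on UNIV"
proof -
  have "summable (\<lambda>n. \<bar>real (\<omega> n) - real (\<omega>' n)\<bar> / 2 ^ n)"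
  proof (rule summable_comparison_test')
    show "summable (\<lambda>n. real (dim_row A) * (1 / 2) ^ n)"
      by (intro summable_mult summable_geometric) simp
    show "norm (\<bar>real (\<omega> n) - real (\<omega>' n)\<bar> / 2 ^ n) \<le> real (dim_row A) * (1 / 2) ^ n" for n
    proof -
      have "\<omega> n \<le> dim_row A" "\<omega>' n \<le> dim_row A"
        using assms by (auto simp: markov_shift_def)
      then have "\<bar>real (\<omega> n) - real (\<omega>' n)\<bar> \<le> real (dim_row A)"
        by linarith
      then show ?thesis
        by (simp add: power_one_over divide_simps)
    qed
  qed
  then show ?thesis
    by (subst summable_on_UNIV_nonneg_real_iff) auto
qed

lemma Metric_space_markov_shift: "Metric_space (markov_shift A) seq_dist"
proof
  fix x y z
  show "0 \<le> seq_dist x y"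
    by (simp add: seq_dist_def infsum_nonneg)
  show "seq_dist x y = seq_dist y x"
    by (simp add: seq_dist_def abs_minus_commute)
  assume x: "x \<in> markov_shift A" and y: "y \<in> markov_shift A"
  show "seq_dist x y = 0 \<longleftrightarrow> x = y"
  proof
    assume "seq_dist x y = 0"
    then have "\<bar>real (x n) - real (y n)\<bar> / 2 ^ n = 0" for n
      unfolding seq_dist_def
      using nonneg_infsum_le_0D[OF _ seq_dist_summable[OF x y], of n] by simp
    then show "x = y"
      by (simp add: fun_eq_iff)
  qed (simp add: seq_dist_def)
  assume z: "z \<in> markov_shift A"
  have "seq_dist x z \<le>
      (\<Sum>\<^sub>\<infinity>n. \<bar>real (x n) - real (y n)\<bar> / 2 ^ n + \<bar>real (y n) - real (z n)\<bar> / 2 ^ n)"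
    unfolding seq_dist_def
    by (intro infsum_mono summable_on_add seq_dist_summable[OF x y] seq_dist_summable[OF y z]
          seq_dist_summable[OF x z]) (simp flip: add_divide_distrib add: divide_right_mono)
  also have "\<dots> = seq_dist x y + seq_dist y z"
    unfolding seq_dist_def
    by (rule infsum_add[OF seq_dist_summable[OF x y] seq_dist_summable[OF y z]])
  finally show "seq_dist x z \<le> seq_dist x y + seq_dist y z" .
qed

definition shift_topology :: "nat mat \<Rightarrow> (nat \<Rightarrow> nat) topology" where
  "shift_topology A = Metric_space.mtopology (markov_shift A) seq_dist"

definition shift_borel :: "nat mat \<Rightarrow> (nat \<Rightarrow> nat) measure" where
  "shift_borel A = sigma (markov_shift A) {U. openin (shift_topology A) U}"

definition cylinder :: "nat mat \<Rightarrow> nat \<Rightarrow> (nat \<Rightarrow> nat) \<Rightarrow> (nat \<Rightarrow> nat) set" where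
  "cylinder A n \<omega> = {\<omega>' \<in> markov_shift A. \<forall>k<n. \<omega>' k = \<omega> k}"

text \<open>
  Functions on the shift space are represented extensionally (\<open>undefined\<close> outside), so that
  equality in HOL is equality as functions on the shift space.
\<close>

definition locally_constant :: "nat \<Rightarrow> nat mat \<Rightarrow> ((nat \<Rightarrow> nat) \<Rightarrow> real) set" where
  "locally_constant n A =
     {\<phi> \<in> markov_shift A \<rightarrow>\<^sub>E UNIV.
        \<forall>\<omega>\<in>markov_shift A. \<forall>\<omega>'\<in>markov_shift A. (\<forall>k<n. \<omega> k = \<omega>' k) \<longrightarrow> \<phi> \<omega> = \<phi> \<omega>'}"

definition invariant_prob :: "nat mat \<Rightarrow> (nat \<Rightarrow> nat) measure \<Rightarrow> bool" where
  "invariant_prob A \<mu> \<longleftrightarrow>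
     prob_space \<mu> \<and> sets \<mu> = sets (shift_borel A) \<and>
     (\<forall>B\<in>sets \<mu>. emeasure \<mu> (shift_map -` B \<inter> space \<mu>) = emeasure \<mu> B)"

definition is_gibbs_measure ::
  "nat mat \<Rightarrow> ((nat \<Rightarrow> nat) \<Rightarrow> real) \<Rightarrow> (nat \<Rightarrow> nat) measure \<Rightarrow> bool" where
  "is_gibbs_measure A f \<mu> \<longleftrightarrow>
     continuous_map (shift_topology A) euclideanreal f \<and>
     invariant_prob A \<mu> \<and>
     (\<exists>C>0. \<exists>P. \<forall>\<omega>\<in>markov_shift A. \<forall>n\<ge>1.
        inverse C \<le> measure \<mu> (cylinder A n \<omega>)
                     / exp (- real n * P + (\<Sum>k<n. f ((shift_map ^^ k) \<omega>))) \<and>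
        measure \<mu> (cylinder A n \<omega>)
          / exp (- real n * P + (\<Sum>k<n. f ((shift_map ^^ k) \<omega>))) \<le> C)"

text \<open>
  Meaningful for potentials with a unique Gibbs measure, in particular for Hoelder continuous
  ones. Since \<open>sets \<mu>\<close> is prescribed, equality of measures is equality on Borel sets.
\<close>

definition gibbs_measure :: "nat mat \<Rightarrow> ((nat \<Rightarrow> nat) \<Rightarrow> real) \<Rightarrow> (nat \<Rightarrow> nat) measure" where
  "gibbs_measure A f = (THE \<mu>. is_gibbs_measure A f \<mu>)"

text \<open>
  A countable cover of \<open>Z\<close> by cylinders of length at least \<open>n\<close> is given by a countable set
  of pairs \<open>(m, \<omega>)\<close> describing the cylinders; it may be finite or empty. In particular the
  empty cover gives entropy \<open>0\<close> for the empty set.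
\<close>

definition cylinder_covers ::
  "nat mat \<Rightarrow> nat \<Rightarrow> (nat \<Rightarrow> nat) set \<Rightarrow> (nat \<times> (nat \<Rightarrow> nat)) set set" where
  "cylinder_covers A n Z =
     {K. countable K \<and> K \<subseteq> {n..} \<times> markov_shift A \<and> Z \<subseteq> (\<Union>(m, \<omega>)\<in>K. cylinder A m \<omega>)}"

definition bowen_entropy :: "nat mat \<Rightarrow> (nat \<Rightarrow> nat) set \<Rightarrow> real" where
  "bowen_entropy A Z =
     Inf {s. 0 \<le> s \<and>
       (\<lambda>n. INF K\<in>cylinder_covers A n Z. \<Sum>\<^sub>\<infinity>(m, \<omega>)\<in>K. ennreal (exp (- s * real m)))
         \<longlonglongrightarrow> 0}"

text \<open>
  The convention \<open>ln 0 = 0\<close> is harmless here: a Gibbs measure gives positive mass to every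
  cylinder around a point of the shift space.
\<close>

definition local_entropy_level ::
  "nat mat \<Rightarrow> (nat \<Rightarrow> nat) measure \<Rightarrow> real \<Rightarrow> (nat \<Rightarrow> nat) set" where
  "local_entropy_level A \<mu> \<alpha> =
     {\<omega> \<in> markov_shift A.
        (\<lambda>n. - (1 / real n) * ln (measure \<mu> (cylinder A n \<omega>))) \<longlonglongrightarrow> \<alpha>}"

definition entropy_spectrum :: "nat mat \<Rightarrow> (nat \<Rightarrow> nat) measure \<Rightarrow> real \<Rightarrow> real" where
  "entropy_spectrum A \<mu> = (\<lambda>\<alpha>. bowen_entropy A (local_entropy_level A \<mu> \<alpha>))"

definition shift_isomorphic ::
  "nat mat \<Rightarrow> (nat \<Rightarrow> nat) measure \<Rightarrow> (nat \<Rightarrow> nat) measure \<Rightarrow> bool" where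
  "shift_isomorphic A \<mu> \<nu> \<longleftrightarrow>
     (\<exists>X Y \<Phi>. X \<in> sets (shift_borel A) \<and> Y \<in> sets (shift_borel A) \<and>
        bij_betw \<Phi> X Y \<and>
        shift_map ` X \<subseteq> X \<and> shift_map ` Y \<subseteq> Y \<and>
        emeasure \<mu> X = 1 \<and> emeasure \<nu> Y = 1 \<and>
        \<Phi> \<in> measurable (restrict_space (shift_borel A) X) (restrict_space (shift_borel A) Y) \<and>
        inv_into X \<Phi>
          \<in> measurable (restrict_space (shift_borel A) Y) (restrict_space (shift_borel A) X) \<and>
        (\<forall>\<omega>\<in>X. \<Phi> (shift_map \<omega>) = shift_map (\<Phi> \<omega>)) \<and>
        (\<forall>B\<in>sets (shift_borel A). B \<subseteq> X \<longrightarrow> emeasure \<mu> B = emeasure \<nu> (\<Phi> ` B)))"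

definition spectrum_class ::
  "nat mat \<Rightarrow> ((nat \<Rightarrow> nat) \<Rightarrow> real) set \<Rightarrow> ((nat \<Rightarrow> nat) \<Rightarrow> real) \<Rightarrow> ((nat \<Rightarrow> nat) \<Rightarrow> real) set" where
  "spectrum_class A \<C> f =
     {g \<in> \<C>. entropy_spectrum A (gibbs_measure A f) = entropy_spectrum A (gibbs_measure A g)}"

definition isomorphism_class ::
  "nat mat \<Rightarrow> ((nat \<Rightarrow> nat) \<Rightarrow> real) set \<Rightarrow> ((nat \<Rightarrow> nat) \<Rightarrow> real) \<Rightarrow> ((nat \<Rightarrow> nat) \<Rightarrow> real) set" where
  "isomorphism_class A \<C> f =
     {g \<in> \<C>. shift_isomorphic A (gibbs_measure A f) (gibbs_measure A g)}"

end

theory Submission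
  imports Defs
begin

text \<open>
  Let \<open>i\<close> be the symbol that may be repeated and \<open>j\<close> the other one. A potential depending on two
  coordinates has as its unique Gibbs measure a stationary Markov measure, determined by the
  probability \<open>p\<close> of the transition \<open>i \<rightarrow> i\<close>. Both equivalence relations turn out to be equality of \<open>p\<close>.

  Almost every point starting with \<open>i\<close> has two preimages inside any set of full measure, while a
  point starting with \<open>j\<close> has only one. Hence an isomorphism preserves the measure \<open>1 / (2 - p)\<close>
  of the set of points whose image has two preimages, and this determines \<open>p\<close>.

  The entropy spectrum vanishes outside of the closed interval with endpoints \<open>- ln p\<close> and
  \<open>- ln (1 - p) / 2\<close>, and it is positive at values converging to either endpoint. The interval
  therefore depends only on the spectrum. If \<open>p\<close> and \<open>p'\<close> have the same interval and differ, then
  \<open>p\<^sup>2 = 1 - p'\<close> and \<open>p'\<^sup>2 = 1 - p\<close>, so \<open>p + p' = 1\<close> and \<open>p\<^sup>2 = p\<close>, which is impossible.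
\<close>

section \<open>The Borel structure of the shift space\<close>

text \<open>The two matrices differ only by exchanging the symbols, so everything is done for
  abstract symbols \<open>i\<close> and \<open>j\<close> with \<open>j\<close> to \<open>j\<close>
  as the only forbidden transition. Since \<open>gibbs_measure\<close> is a definite description
  over all invariant probabilities with the Gibbs bounds, uniqueness must be proved; a second-moment
  estimate replaces ergodic theory and transfer operators. Entropy would not serve as the invariant
  of isomorphism: as a function of p it tends to 0 at both ends of (0, 1), so it is not injective.
  Counting preimages is possible because the shift is not invertible; the difficulty is that the
  sets \<open>X\<close> and \<open>Y\<close> may omit null sets. The spectrum is never computed. The
  endpoints of its interval are the costs per step of the two simple cycles, \<open>i\<close> to
  \<open>i\<close> and \<open>i\<close> to \<open>j\<close> to \<open>i\<close>. The spectrum may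
  vanish at the endpoints themselves, so they are approached through values at which a free choice
  between two blocks yields positive entropy.\<close>

lemma infsum_single_le:
  fixes f :: "'a \<Rightarrow> real"
  assumes "f summable_on A" "x \<in> A" "\<And>y. y \<in> A \<Longrightarrow> 0 \<le> f y"
  shows "f x \<le> infsum f A"
proof -
  have "infsum f {x} \<le> infsum f A"
    by (rule infsum_mono_neutral) (use assms in auto)
  then show ?thesis by simp
qed

lemma seq_dist_coordinate:
  assumes "\<omega> \<in> markov_shift A" "\<omega>' \<in> markov_shift A"
  shows "\<bar>real (\<omega> k) - real (\<omega>' k)\<bar> / 2 ^ k \<le> seq_dist \<omega> \<omega>'"
  unfolding seq_dist_def by (rule infsum_single_le[OF seq_dist_summable[OF assms]]) auto

lemma seq_dist_le:
  assumes x: "\<omega> \<in> markov_shift A" and y: "\<omega>' \<in> markov_shift A" and eq: "\<And>k. k < n \<Longrightarrow> \<omega> k = \<omega>' k"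
  shows "seq_dist \<omega> \<omega>' \<le> 2 * real (dim_row A) / 2 ^ n"
proof -
  let ?f = "\<lambda>k. \<bar>real (\<omega> k) - real (\<omega>' k)\<bar> / 2 ^ k"
  have s: "summable ?f"
    using seq_dist_summable[OF x y] by (subst (asm) summable_on_UNIV_nonneg_real_iff) auto
  have le: "?f (k + n) \<le> real (dim_row A) / 2 ^ n * (1 / 2) ^ k" for k
  proof -
    have "\<omega> (k + n) \<le> dim_row A" "\<omega>' (k + n) \<le> dim_row A"
      using x y by (auto simp: markov_shift_def)
    then have "\<bar>real (\<omega> (k + n)) - real (\<omega>' (k + n))\<bar> \<le> real (dim_row A)"
      by linarith
    then show ?thesis
      by (simp add: power_add power_one_over divide_simps)
  qed
  have "seq_dist \<omega> \<omega>' = suminf ?f"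
    unfolding seq_dist_def
    using s by (intro infsumI sums_nonneg_imp_has_sum) (auto simp: sums_iff)
  also have "\<dots> = (\<Sum>k. ?f (k + n)) + (\<Sum>k<n. ?f k)"
    by (rule suminf_split_initial_segment[OF s])
  also have "(\<Sum>k<n. ?f k) = 0"
    by (rule sum.neutral) (use eq in auto)
  also have "(\<Sum>k. ?f (k + n)) \<le> (\<Sum>k. real (dim_row A) / 2 ^ n * (1 / 2) ^ k)"
    by (intro suminf_le le summable_ignore_initial_segment[OF s] summable_mult summable_geometric) simp
  also have "\<dots> = real (dim_row A) / 2 ^ n * 2"
    by (subst suminf_mult) (auto simp: suminf_geometric)
  finally show ?thesis by (simp add: mult.commute)
qed

lemma topspace_shift_topology: "topspace (shift_topology A) = markov_shift A"
  by (simp add: shift_topology_def Metric_space.topspace_mtopology[OF Metric_space_markov_shift])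

text \<open>Symbols are integers, so a disagreement at position k already costs distance 2^(-k),
  while agreement on the first n positions leaves only a geometric tail. Hence balls and cylinders
  around a point are cofinal in each other.\<close>

lemma openin_shift_topology_iff:
  "openin (shift_topology A) U \<longleftrightarrow> U \<subseteq> markov_shift A \<and> (\<forall>\<omega>\<in>U. \<exists>n. cylinder A n \<omega> \<subseteq> U)"
proof -
  interpret M: Metric_space "markov_shift A" seq_dist
    by (rule Metric_space_markov_shift)
  have "\<exists>n. cylinder A n \<omega> \<subseteq> U"
    if "U \<subseteq> markov_shift A" "\<omega> \<in> U" "r > 0" "M.mball \<omega> r \<subseteq> U" for \<omega> r
  proof -
    have "(\<lambda>n. 2 * real (dim_row A) / 2 ^ n) \<longlonglongrightarrow> 0"
      by real_asymp
    then have "\<forall>\<^sub>F n in sequentially. 2 * real (dim_row A) / 2 ^ n < r"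
      using \<open>r > 0\<close> by (rule order_tendstoD)
    then obtain n where n: "2 * real (dim_row A) / 2 ^ n < r"
      by (auto simp: eventually_sequentially)
    have "cylinder A n \<omega> \<subseteq> M.mball \<omega> r"
    proof
      fix \<omega>' assume "\<omega>' \<in> cylinder A n \<omega>"
      then have "\<omega>' \<in> markov_shift A" "\<And>k. k < n \<Longrightarrow> \<omega> k = \<omega>' k"
        by (auto simp: cylinder_def)
      moreover have "\<omega> \<in> markov_shift A" using that(1,2) by blast
      ultimately show "\<omega>' \<in> M.mball \<omega> r"
        using seq_dist_le[of \<omega> A \<omega>' n] n by (simp add: M.mball_def)
    qed
    then show ?thesis using that(4) by blast
  qed
  moreover have "\<exists>r>0. M.mball \<omega> r \<subseteq> U"
    if "U \<subseteq> markov_shift A" "\<omega> \<in> U" "cylinder A n \<omega> \<subseteq> U" for \<omega> n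
  proof (intro exI conjI)
    show "(1 / 2 ^ n :: real) > 0" by simp
    have "\<omega>' k = \<omega> k" if "\<omega>' \<in> M.mball \<omega> (1 / 2 ^ n)" "k < n" for \<omega>' k
    proof (rule ccontr)
      assume "\<omega>' k \<noteq> \<omega> k"
      then have "1 \<le> \<bar>real (\<omega> k) - real (\<omega>' k)\<bar>" by linarith
      then have "1 / 2 ^ k \<le> \<bar>real (\<omega> k) - real (\<omega>' k)\<bar> / 2 ^ k"
        by (simp add: divide_right_mono)
      also have "\<dots> \<le> seq_dist \<omega> \<omega>'"
        using that(1) by (intro seq_dist_coordinate) auto
      also have "\<dots> < 1 / 2 ^ n" using that(1) by simp
      also have "\<dots> \<le> 1 / 2 ^ k"
        using \<open>k < n\<close> by (simp add: frac_le)
      finally show False by simp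
    qed
    then have "M.mball \<omega> (1 / 2 ^ n) \<subseteq> cylinder A n \<omega>"
      by (auto simp: cylinder_def)
    then show "M.mball \<omega> (1 / 2 ^ n) \<subseteq> U" using that(3) by blast
  qed
  ultimately show ?thesis
    unfolding shift_topology_def M.openin_mtopology by metis
qed

lemma openin_cylinder: "openin (shift_topology A) (cylinder A n \<omega>)"
  unfolding openin_shift_topology_iff by (auto simp: cylinder_def intro!: exI[of _ n])

lemma continuous_map_locally_constant:
  assumes "f \<in> locally_constant n A"
  shows "continuous_map (shift_topology A) euclideanreal f"
  unfolding continuous_map topspace_shift_topology openin_shift_topology_iff
proof (intro conjI allI impI ballI)
  fix U \<omega> assume "\<omega> \<in> {\<omega> \<in> markov_shift A. f \<omega> \<in> U}"
  then show "\<exists>n. cylinder A n \<omega> \<subseteq> {\<omega> \<in> markov_shift A. f \<omega> \<in> U}"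
    using assms unfolding locally_constant_def cylinder_def
    by (intro exI[of _ n]) (smt (verit, ccfv_threshold) mem_Collect_eq subsetI)
qed auto

section \<open>Borel sets and their generation by word cylinders\<close>

lemma space_shift_borel [simp]: "space (shift_borel A) = markov_shift A"
  by (simp add: shift_borel_def space_measure_of_conv)

lemma sets_shift_borel:
  "sets (shift_borel A) = sigma_sets (markov_shift A) (Collect (openin (shift_topology A)))"
  unfolding shift_borel_def
  by (rule sets_measure_of) (auto simp: openin_shift_topology_iff)

lemma shift_map_markov_shift: "\<omega> \<in> markov_shift A \<Longrightarrow> shift_map \<omega> \<in> markov_shift A"
  by (simp add: markov_shift_def shift_map_def)

lemma shift_map_funpow: "(shift_map ^^ k) \<omega> = (\<lambda>n. \<omega> (n + k))"
  by (induction k) (auto simp: shift_map_def)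

lemma cylinder_in_sets [measurable]: "cylinder A n \<omega> \<in> sets (shift_borel A)"
  unfolding sets_shift_borel by (rule sigma_sets.Basic) (simp add: openin_cylinder)

text \<open>Indexed by words instead of points: the index set is countable, letters can be added at
  either end, and forbidden words get the empty set.\<close>

definition word_cylinder :: "nat mat \<Rightarrow> nat list \<Rightarrow> (nat \<Rightarrow> nat) set" where
  "word_cylinder A u = {\<omega> \<in> markov_shift A. map \<omega> [0..<length u] = u}"

lemma mem_word_cylinder:
  "\<omega> \<in> word_cylinder A u \<longleftrightarrow> \<omega> \<in> markov_shift A \<and> (\<forall>k<length u. \<omega> k = u ! k)"
proof -
  have "map \<omega> [0..<length u] = u \<longleftrightarrow> (\<forall>k<length u. \<omega> k = u ! k)"
    by (subst list_eq_iff_nth_eq) auto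
  then show ?thesis by (simp add: word_cylinder_def)
qed

lemma cylinder_eq_word_cylinder: "cylinder A n \<omega> = word_cylinder A (map \<omega> [0..<n])"
  by (auto simp: cylinder_def mem_word_cylinder)

lemma word_cylinder_eq_cylinder:
  "\<omega> \<in> word_cylinder A u \<Longrightarrow> word_cylinder A u = cylinder A (length u) \<omega>"
  by (auto simp: cylinder_def mem_word_cylinder)

lemma word_cylinder_in_sets [measurable]: "word_cylinder A u \<in> sets (shift_borel A)"
  by (cases "word_cylinder A u = {}") (auto dest!: word_cylinder_eq_cylinder)

text \<open>There are only countably many words, so every open set is a countable union of word
  cylinders.\<close>

lemma sets_shift_borel_eq:
  "sets (shift_borel A) = sigma_sets (markov_shift A) (range (word_cylinder A))"
proof -
  have "sets (shift_borel A) = sigma_sets (markov_shift A) (Collect (openin (shift_topology A)))"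
    by (rule sets_shift_borel)
  also have "\<dots> = sigma_sets (markov_shift A) (range (word_cylinder A))"
  proof (rule sigma_sets_eqI)
    fix U assume "U \<in> Collect (openin (shift_topology A))"
    then have U: "U \<subseteq> markov_shift A" "\<And>\<omega>. \<omega> \<in> U \<Longrightarrow> \<exists>n. cylinder A n \<omega> \<subseteq> U"
      by (auto simp: openin_shift_topology_iff)
    have "U = (\<Union>u\<in>{u. word_cylinder A u \<subseteq> U}. word_cylinder A u)"
    proof (intro equalityI subsetI)
      fix \<omega> assume "\<omega> \<in> U"
      with U obtain n where "cylinder A n \<omega> \<subseteq> U" by blast
      moreover have "\<omega> \<in> cylinder A n \<omega>"
        using U \<open>\<omega> \<in> U\<close> by (auto simp: cylinder_def)
      ultimately show "\<omega> \<in> (\<Union>u\<in>{u. word_cylinder A u \<subseteq> U}. word_cylinder A u)"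
        unfolding cylinder_eq_word_cylinder by blast
    qed auto
    also have "\<dots> \<in> sigma_sets (markov_shift A) (range (word_cylinder A))"
      by (rule sigma_sets_UNION)
         (auto intro!: countable_subset[OF subset_UNIV] sigma_sets.Basic)
    finally show "U \<in> sigma_sets (markov_shift A) (range (word_cylinder A))" .
  next
    fix C assume "C \<in> range (word_cylinder A)"
    then obtain u where "C = word_cylinder A u" by blast
    moreover have "word_cylinder A u \<in> sets (shift_borel A)" by measurable
    ultimately show "C \<in> sigma_sets (markov_shift A) (Collect (openin (shift_topology A)))"
      unfolding sets_shift_borel by simp
  qed
  finally show ?thesis .
qed

lemma word_cylinder_Nil [simp]: "word_cylinder A [] = markov_shift A"
  by (simp add: word_cylinder_def)

lemma word_cylinder_Int:
  "word_cylinder A u \<inter> word_cylinder A v = {} \<or>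
   word_cylinder A u \<inter> word_cylinder A v = word_cylinder A (if length u \<le> length v then v else u)"
proof (cases "word_cylinder A u \<inter> word_cylinder A v = {}")
  case False
  then obtain \<omega> where "\<omega> \<in> word_cylinder A u" "\<omega> \<in> word_cylinder A v" by blast
  then have "word_cylinder A u \<inter> word_cylinder A v = word_cylinder A (if length u \<le> length v then v else u)"
    by (auto simp: mem_word_cylinder)
  then show ?thesis ..
qed simp

text \<open>Word cylinders are nested or disjoint, so they form a pi-system once the empty set is
  added; the whole space is the cylinder of the empty word.\<close>

lemma shift_measure_eqI:
  assumes M: "sets M = sets (shift_borel A)" and N: "sets N = sets (shift_borel A)"
    and fin: "emeasure M (space M) \<noteq> \<infinity>"
    and eq: "\<And>u. emeasure M (word_cylinder A u) = emeasure N (word_cylinder A u)"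
  shows "M = N"
proof (rule measure_eqI_generator_eq[where E = "insert {} (range (word_cylinder A))"
        and A = "\<lambda>_. markov_shift A" and \<Omega> = "markov_shift A"])
  show "Int_stable (insert {} (range (word_cylinder A)))"
  proof (rule Int_stableI)
    fix a b assume "a \<in> insert {} (range (word_cylinder A))" "b \<in> insert {} (range (word_cylinder A))"
    then consider "a \<inter> b = {}" | u v where "a = word_cylinder A u" "b = word_cylinder A v"
      by auto
    then show "a \<inter> b \<in> insert {} (range (word_cylinder A))"
    proof cases
      case 2
      then show ?thesis using word_cylinder_Int[of A u v] by (metis insertCI rangeI)
    qed simp
  qed
  show "sets M = sigma_sets (markov_shift A) (insert {} (range (word_cylinder A)))"
    "sets N = sigma_sets (markov_shift A) (insert {} (range (word_cylinder A)))"
    unfolding M N sets_shift_borel_eq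
    by (rule sigma_sets_eqI; auto intro: sigma_sets.Empty)+
  show "insert {} (range (word_cylinder A)) \<subseteq> Pow (markov_shift A)"
    by (auto simp: word_cylinder_def)
  show "range (\<lambda>_. markov_shift A) \<subseteq> insert {} (range (word_cylinder A))"
    by (auto intro: range_eqI[of _ _ "[]"])
  have "space M = markov_shift A" using sets_eq_imp_space_eq[OF M] by simp
  then show "emeasure M (markov_shift A) \<noteq> \<infinity>" using fin by simp
qed (use eq in auto)

lemma measurable_shift_coordinate [measurable]:
  "(\<lambda>\<omega>. \<omega> k) \<in> measurable (shift_borel A) (count_space UNIV)"
proof (rule measurable_count_space_eq2_countable[THEN iffD2], intro conjI allI ballI)
  fix s
  let ?U = "{\<omega> \<in> markov_shift A. \<omega> k = s}"
  have "openin (shift_topology A) ?U"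
    unfolding openin_shift_topology_iff cylinder_def
    by (auto intro!: exI[of _ "Suc k"])
  then have "?U \<in> sets (shift_borel A)"
    unfolding sets_shift_borel by (intro sigma_sets.Basic) simp
  moreover have "(\<lambda>\<omega>. \<omega> k) -` {s} \<inter> space (shift_borel A) = ?U"
    by auto
  ultimately show "(\<lambda>\<omega>. \<omega> k) -` {s} \<inter> space (shift_borel A) \<in> sets (shift_borel A)"
    by simp
qed auto

lemma measurable_shift_borelI:
  assumes "\<And>x. x \<in> space M \<Longrightarrow> F x \<in> markov_shift A"
    and [measurable]: "\<And>k. (\<lambda>x. F x k) \<in> measurable M (count_space UNIV)"
  shows "F \<in> measurable M (shift_borel A)"
proof (rule measurable_sigma_sets[OF sets_shift_borel_eq])
  fix C assume "C \<in> range (word_cylinder A)"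
  then obtain u where C: "C = word_cylinder A u" by blast
  have "F -` C \<inter> space M = {x \<in> space M. \<forall>k\<in>{..<length u}. F x k = u ! k}"
    using assms(1) by (auto simp: C mem_word_cylinder)
  also have "\<dots> \<in> sets M" by measurable
  finally show "F -` C \<inter> space M \<in> sets M" .
qed (use assms(1) in \<open>auto simp: word_cylinder_def\<close>)

lemma measurable_shift_map [measurable]: "shift_map \<in> measurable (shift_borel A) (shift_borel A)"
  by (rule measurable_shift_borelI) (auto simp: shift_map_markov_shift, simp add: shift_map_def)

section \<open>Stationary Markov measures on the golden mean shift\<close>

text \<open>The bias depends on the index because the initial symbol is drawn with its stationary
  probability and the later ones with the transition probability.\<close>

definition coin_flips :: "(nat \<Rightarrow> real) \<Rightarrow> (nat \<Rightarrow> bool) measure" where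
  "coin_flips r = (\<Pi>\<^sub>M n\<in>UNIV. measure_pmf (bernoulli_pmf (r n)))"

lemma space_coin_flips [simp]: "space (coin_flips r) = UNIV"
  by (auto simp: coin_flips_def space_PiM)

lemma prob_space_coin_flips: "prob_space (coin_flips r)"
  unfolding coin_flips_def by (intro prob_space_PiM prob_space_measure_pmf)

lemma measurable_coin_flips [measurable]: "(\<lambda>b. b k) \<in> measurable (coin_flips r) (count_space UNIV)"
  unfolding coin_flips_def
  using measurable_component_singleton[of k UNIV "\<lambda>n. measure_pmf (bernoulli_pmf (r n))"]
  by (simp cong: measurable_cong_sets)

lemma measure_coin_flips:
  "measure (coin_flips r) {b. \<forall>k<n. b k \<in> B k} = (\<Prod>k<n. measure (bernoulli_pmf (r k)) (B k))"
proof -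
  interpret product_prob_space "\<lambda>n. measure_pmf (bernoulli_pmf (r n))" UNIV
    by unfold_locales
  have emb: "{b. \<forall>k<n. b k \<in> B k} =
      prod_emb UNIV (\<lambda>n. measure_pmf (bernoulli_pmf (r n))) {..<n} (Pi\<^sub>E {..<n} B)"
    by (simp add: prod_emb_def restrict_PiE_iff set_eq_iff Pi_iff Ball_def)
  show ?thesis
    unfolding coin_flips_def emb
    by (rule measure_PiM_emb) (simp_all only: subset_UNIV finite_lessThan sets_measure_pmf UNIV_I)
qed

section \<open>Words over two symbols with one forbidden transition\<close>

locale golden_mean_shift =
  fixes A :: "nat mat" and i j :: nat
  assumes markov_shift_eq:
      "markov_shift A = {\<omega>. \<forall>n. \<omega> n \<in> {i, j} \<and> (\<omega> n = j \<longrightarrow> \<omega> (Suc n) = i)}"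
    and neq: "i \<noteq> j"
begin

text \<open>Forbidden words are included, so that sums split freely at the first or the last letter;
  they contribute nothing, having empty cylinders and weight 0.\<close>

definition words :: "nat \<Rightarrow> nat list set" where
  "words n = {u. set u \<subseteq> {i, j} \<and> length u = n}"

lemma finite_words [simp]: "finite (words n)"
  unfolding words_def by (rule finite_lists_length_eq) simp

lemma words_0 [simp]: "words 0 = {[]}"
  by (auto simp: words_def)

lemma sum_words_Suc:
  fixes g :: "nat list \<Rightarrow> 'a::comm_monoid_add"
  shows "sum g (words (Suc n)) = (\<Sum>u\<in>words n. g (i # u) + g (j # u))"
proof -
  have "words (Suc n) = (\<lambda>u. i # u) ` words n \<union> (\<lambda>u. j # u) ` words n"
    by (auto simp: words_def length_Suc_conv)
  then have "sum g (words (Suc n)) = sum g ((\<lambda>u. i # u) ` words n) + sum g ((\<lambda>u. j # u) ` words n)"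
    using neq by (simp only:) (rule sum.union_disjoint, auto)
  then show ?thesis
    by (simp add: sum.reindex sum.distrib)
qed

lemma sum_words_Suc':
  fixes g :: "nat list \<Rightarrow> 'a::comm_monoid_add"
  shows "sum g (words (Suc n)) = (\<Sum>u\<in>words n. g (u @ [i]) + g (u @ [j]))"
proof -
  have "words (Suc n) = (\<lambda>u. u @ [i]) ` words n \<union> (\<lambda>u. u @ [j]) ` words n"
    by (auto simp: words_def length_Suc_conv_rev)
  then have "sum g (words (Suc n)) = sum g ((\<lambda>u. u @ [i]) ` words n) + sum g ((\<lambda>u. u @ [j]) ` words n)"
    using neq by (simp only:) (rule sum.union_disjoint, auto)
  then show ?thesis
    by (simp add: sum.reindex inj_on_def sum.distrib)
qed

lemma card_words: "card (words n) = 2 ^ n"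
  unfolding words_def using neq by (subst card_lists_length_eq) (auto simp: numeral_2_eq_2)

lemma prefix_in_words: "\<omega> \<in> markov_shift A \<Longrightarrow> map \<omega> [0..<n] \<in> words n"
  by (auto simp: words_def markov_shift_eq)

lemma word_cylinder_empty_jj:
  assumes "Suc k < length u" "u ! k = j" "u ! Suc k = j"
  shows "word_cylinder A u = {}"
proof (rule equals0I)
  fix \<omega> assume "\<omega> \<in> word_cylinder A u"
  then have "\<omega> k = j" "\<omega> (Suc k) = j" "\<omega> \<in> markov_shift A"
    using assms by (auto simp: mem_word_cylinder)
  then show False using neq by (auto simp: markov_shift_eq)
qed

lemma word_cylinder_empty:
  assumes "u \<notin> words (length u)"
  shows "word_cylinder A u = {}"
  using assms prefix_in_words[of _ "length u"] by (force simp: word_cylinder_def)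

lemma word_cylinder_append:
  "word_cylinder A u = word_cylinder A (u @ [i]) \<union> word_cylinder A (u @ [j])"
  "word_cylinder A (u @ [i]) \<inter> word_cylinder A (u @ [j]) = {}"
  using neq by (auto simp: word_cylinder_def markov_shift_eq)

lemma word_cylinder_Cons:
  "shift_map -` word_cylinder A u \<inter> markov_shift A = word_cylinder A (i # u) \<union> word_cylinder A (j # u)"
  "word_cylinder A (i # u) \<inter> word_cylinder A (j # u) = {}"
proof -
  have "map \<omega> [0..<Suc n] = \<omega> 0 # map (shift_map \<omega>) [0..<n]" for \<omega> :: "nat \<Rightarrow> nat" and n
    by (simp add: map_upt_Suc shift_map_def del: upt_Suc)
  then show "shift_map -` word_cylinder A u \<inter> markov_shift A = word_cylinder A (i # u) \<union> word_cylinder A (j # u)"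
    "word_cylinder A (i # u) \<inter> word_cylinder A (j # u) = {}"
    using neq shift_map_markov_shift[of _ A]
    by (auto simp: word_cylinder_def simp del: upt_Suc) (auto simp: markov_shift_eq)
qed

section \<open>Transition probabilities and weights of words\<close>

definition step :: "real \<Rightarrow> nat \<Rightarrow> nat \<Rightarrow> real" where
  "step p s t = (if s = i then if t = i then p else 1 - p else if t = i then 1 else 0)"

text \<open>The invariant law of \<open>step p\<close>: the mass of \<open>j\<close> is 1 - p times
  that of \<open>i\<close>, and total mass 1 forces the factor 1 / (2 - p).\<close>

definition stationary :: "real \<Rightarrow> nat \<Rightarrow> real" where
  "stationary p s = (if s = i then 1 / (2 - p) else (1 - p) / (2 - p))"

text \<open>The initial factor is placed at position 0 of a single product over positions, so that
  the product can be matched flip by flip with \<open>measure_coin_flips\<close>.\<close>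

definition weight :: "real \<Rightarrow> nat list \<Rightarrow> real" where
  "weight p u = (\<Prod>k<length u. if k = 0 then stationary p (u ! 0) else step p (u ! (k - 1)) (u ! k))"

lemma weight_Nil [simp]: "weight p [] = 1"
  by (simp add: weight_def)

lemma weight_single [simp]: "weight p [s] = stationary p s"
  by (simp add: weight_def)

lemma weight_snoc: "weight p (u @ [s, t]) = weight p (u @ [s]) * step p s t"
  by (auto simp: weight_def nth_append intro!: prod.cong)

lemma weight_snoc': "u \<noteq> [] \<Longrightarrow> weight p (u @ [t]) = weight p u * step p (last u) t"
  using weight_snoc[of p "butlast u" "last u" t] append_butlast_last_id[of u]
  by (metis append.assoc append_Cons append_Nil)

text \<open>The stationary chain is reversible, so the backward transition probabilities are the forward ones.\<close>

lemma stationary_step: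
  assumes "s \<in> {i, j}" "t \<in> {i, j}"
  shows "stationary p s * step p s t = stationary p t * step p t s"
  using assms neq by (auto simp: stationary_def step_def)

text \<open>The induction adds letters at the end, where weights are recursive; reversibility enters
  at words of length one. Prepending a letter thus costs a transition probability too, which is what
  invariance under the shift requires.\<close>

lemma weight_Cons:
  assumes "s \<in> {i, j}" "u \<noteq> []" "hd u \<in> {i, j}"
  shows "weight p (s # u) = step p (hd u) s * weight p u"
  using assms(2,3)
proof (induction u rule: rev_induct)
  case (snoc t u)
  show ?case
  proof (cases "u = []")
    case True
    then show ?thesis
      using weight_snoc[of p "[]" s t] stationary_step[OF assms(1), of t p] snoc.prems by simp
  next
    case False
    then show ?thesis
      using snoc weight_snoc'[of "s # u" p t] weight_snoc'[of u p t] by simp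
  qed
qed simp

lemma sum_step: "step p s i + step p s j = 1"
  using neq by (auto simp: step_def)

lemma weight_Cons_sum:
  assumes "u \<noteq> []" "hd u \<in> {i, j}"
  shows "weight p u = weight p (i # u) + weight p (j # u)"
  using assms by (simp add: weight_Cons sum_step flip: distrib_right)

text \<open>After \<open>j\<close> the flip is ignored, so every sequence of flips gives an
  admissible point and no null set has to be discarded.\<close>

primrec walk :: "(nat \<Rightarrow> bool) \<Rightarrow> nat \<Rightarrow> nat" where
  "walk b 0 = (if b 0 then i else j)"
| "walk b (Suc n) = (if walk b n = j then i else if b (Suc n) then i else j)"

definition markov_measure :: "real \<Rightarrow> (nat \<Rightarrow> nat) measure" where
  "markov_measure p = distr (coin_flips (\<lambda>k. if k = 0 then 1 / (2 - p) else p)) (shift_borel A) walk"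

lemma walk_in_markov_shift: "walk b \<in> markov_shift A"
  unfolding markov_shift_eq
proof (intro CollectI allI conjI)
  show "walk b n \<in> {i, j}" for n by (cases n) auto
qed simp

lemma measurable_walk [measurable]: "walk \<in> measurable (coin_flips r) (shift_borel A)"
proof (rule measurable_shift_borelI)
  show "(\<lambda>b. walk b k) \<in> measurable (coin_flips r) (count_space UNIV)" for k
    by (induction k) (simp_all, measurable)
qed (rule walk_in_markov_shift)

lemma sets_markov_measure [simp, measurable_cong]: "sets (markov_measure p) = sets (shift_borel A)"
  by (simp add: markov_measure_def)

lemma space_markov_measure [simp]: "space (markov_measure p) = markov_shift A"
  by (simp add: markov_measure_def)

lemma prob_space_markov_measure: "prob_space (markov_measure p)"
  unfolding markov_measure_def by (intro prob_space.prob_space_distr prob_space_coin_flips measurable_walk)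

lemma weight_eq_0_jj:
  assumes "Suc k < length u" "u ! k = j" "u ! Suc k = j"
  shows "weight p u = 0"
  unfolding weight_def using assms neq
  by (intro prod_zero bexI[of _ "Suc k"]) (auto simp: step_def)

lemma measure_markov_measure:
  assumes p: "0 < p" "p < 1" and u: "set u \<subseteq> {i, j}"
  shows "measure (markov_measure p) (word_cylinder A u) = weight p u"
proof (cases "\<exists>k. Suc k < length u \<and> u ! k = j \<and> u ! Suc k = j")
  case True
  then show ?thesis
    using word_cylinder_empty_jj weight_eq_0_jj by (metis measure_empty)
next
  case False
  have mem: "u ! k \<in> {i, j}" if "k < length u" for k
    using u that nth_mem by blast
  \<comment> \<open>The outcomes of flip \<open>k\<close> that are compatible with \<open>u\<close>.
    The braces contain a truth value; after \<open>j\<close> the flip is free. Position 0 needs its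
    own clause, since \<open>k - 1\<close> is then 0 again.\<close>
  define B where "B = (\<lambda>k. if k = 0 \<or> u ! (k - 1) = i then {u ! k = i} else UNIV)"
  have *: "(\<forall>k<n. walk b k = u ! k) \<longleftrightarrow> (\<forall>k<n. b k \<in> B k)" if "n \<le> length u" for n b
    using that
  proof (induction n)
    case (Suc n)
    have "walk b n = u ! n \<longleftrightarrow> b n \<in> B n" if "\<forall>k<n. walk b k = u ! k"
    proof (cases n)
      case 0
      then show ?thesis using mem[of 0] Suc.prems neq by (cases u) (auto simp: B_def)
    next
      case (Suc m)
      then have "walk b m = u ! m" using that by simp
      then show ?thesis
        using Suc mem[of n] mem[of m] \<open>Suc n \<le> length u\<close> neq False by (auto simp: B_def)
    qed
    then show ?case using Suc by (auto simp: less_Suc_eq)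
  qed simp
  have "measure (markov_measure p) (word_cylinder A u) =
      measure (coin_flips (\<lambda>k. if k = 0 then 1 / (2 - p) else p)) (walk -` word_cylinder A u)"
    unfolding markov_measure_def by (subst measure_distr) (simp_all add: measurable_walk word_cylinder_in_sets)
  also have "walk -` word_cylinder A u = {b. \<forall>k<length u. b k \<in> B k}"
    using *[OF order_refl] by (auto simp: mem_word_cylinder walk_in_markov_shift)
  also have "measure (coin_flips (\<lambda>k. if k = 0 then 1 / (2 - p) else p)) \<dots> = weight p u"
    unfolding measure_coin_flips weight_def
  proof (intro prod.cong refl)
    fix k assume k: "k \<in> {..<length u}"
    have v: "u ! k = i" if "k \<noteq> 0" "u ! (k - 1) = j"
      using False mem[of k] k that by (auto simp: gr0_conv_Suc)
    have "u ! (k - 1) \<in> {i, j}" using mem k by simp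
    then show "measure (bernoulli_pmf (if k = 0 then 1 / (2 - p) else p)) (B k) =
        (if k = 0 then stationary p (u ! 0) else step p (u ! (k - 1)) (u ! k))"
      using p neq mem[of k] k v
      by (auto simp: B_def measure_pmf_single stationary_def step_def field_simps)
  qed
  finally show ?thesis .
qed

lemma emeasure_markov_measure:
  assumes "0 < p" "p < 1" "set u \<subseteq> {i, j}"
  shows "emeasure (markov_measure p) (word_cylinder A u) = ennreal (weight p u)"
proof -
  interpret prob_space "markov_measure p" by (rule prob_space_markov_measure)
  show ?thesis using measure_markov_measure[OF assms] by (simp add: emeasure_eq_measure)
qed

text \<open>Taking the preimage under the shift prepends a letter, so additivity at the front is
  where invariance enters; additivity at the end is that of any measure.\<close>

lemma invariant_measure_Cons:
  assumes "invariant_prob A \<nu>"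
  shows "measure \<nu> (word_cylinder A u) = measure \<nu> (word_cylinder A (i # u)) + measure \<nu> (word_cylinder A (j # u))"
proof -
  interpret prob_space \<nu> using assms by (simp add: invariant_prob_def)
  have S: "sets \<nu> = sets (shift_borel A)" using assms by (simp add: invariant_prob_def)
  then have sp: "space \<nu> = markov_shift A" using sets_eq_imp_space_eq[of \<nu> "shift_borel A"] by simp
  have [measurable]: "word_cylinder A v \<in> sets \<nu>" for v by (simp add: S)
  have "measure \<nu> (word_cylinder A u) = measure \<nu> (shift_map -` word_cylinder A u \<inter> markov_shift A)"
    using assms sp by (simp add: invariant_prob_def measure_def)
  also have "\<dots> = measure \<nu> (word_cylinder A (i # u)) + measure \<nu> (word_cylinder A (j # u))"
    unfolding word_cylinder_Cons(1) by (rule finite_measure_Union) (auto simp: word_cylinder_Cons(2))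
  finally show ?thesis .
qed

lemma prob_measure_append:
  assumes "prob_space \<nu>" and S: "sets \<nu> = sets (shift_borel A)"
  shows "measure \<nu> (word_cylinder A u) = measure \<nu> (word_cylinder A (u @ [i])) + measure \<nu> (word_cylinder A (u @ [j]))"
proof -
  interpret prob_space \<nu> by fact
  have [measurable]: "word_cylinder A v \<in> sets \<nu>" for v by (simp add: S)
  show ?thesis
    unfolding word_cylinder_append(1)[of u]
    by (rule finite_measure_Union) (auto simp: word_cylinder_append(2))
qed

lemma sum_measure_words:
  assumes "prob_space \<nu>" and S: "sets \<nu> = sets (shift_borel A)"
  shows "(\<Sum>u\<in>words n. measure \<nu> (word_cylinder A u)) = 1"
proof (induction n)
  case 0
  interpret prob_space \<nu> by fact
  show ?case using prob_space sets_eq_imp_space_eq[OF S] by simp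
next
  case (Suc n)
  then show ?case
    by (simp add: sum_words_Suc' prob_measure_append[OF assms, symmetric])
qed

lemma invariant_markov_measure:
  assumes p: "0 < p" "p < 1"
  shows "invariant_prob A (markov_measure p)"
proof -
  interpret prob_space "markov_measure p" by (rule prob_space_markov_measure)
  have "distr (markov_measure p) (shift_borel A) shift_map = markov_measure p"
  proof (rule shift_measure_eqI)
    fix u
    have *: "emeasure (distr (markov_measure p) (shift_borel A) shift_map) (word_cylinder A u) =
      emeasure (markov_measure p) (word_cylinder A (i # u)) + emeasure (markov_measure p) (word_cylinder A (j # u))"
      by (subst emeasure_distr)
         (simp_all add: word_cylinder_Cons plus_emeasure)
    show "emeasure (distr (markov_measure p) (shift_borel A) shift_map) (word_cylinder A u) =
        emeasure (markov_measure p) (word_cylinder A u)"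
    proof (cases "set u \<subseteq> {i, j}")
      case True
      have "0 \<le> weight p (s # u)" if "s \<in> {i, j}" for s
        using measure_markov_measure[OF p, of "s # u"] True that
        by (metis insert_subset list.simps(15) measure_nonneg)
      moreover have "weight p u = weight p (i # u) + weight p (j # u)"
      proof (cases u)
        \<comment> \<open>The empty word has no first letter; here the identity says that the
          stationary masses add up to 1.\<close>
        case Nil
        then show ?thesis using p neq by (simp add: stationary_def field_simps)
      qed (use True in \<open>auto intro!: weight_Cons_sum\<close>)
      ultimately show ?thesis
        using True unfolding * by (simp add: emeasure_markov_measure[OF p] flip: ennreal_plus)
    next
      case False
      then show ?thesis
        unfolding * by (subst (1 2 3) word_cylinder_empty) (auto simp: words_def)
    qed
  qed (auto intro!: finite_measure.emeasure_finite prob_space.finite_measure prob_space_distr)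
  then have "emeasure (markov_measure p) (shift_map -` B \<inter> space (markov_measure p)) = emeasure (markov_measure p) B"
    if "B \<in> sets (markov_measure p)" for B
    using that emeasure_distr[of shift_map "markov_measure p" "shift_borel A" B] by simp
  then show ?thesis
    using prob_space_markov_measure by (simp add: invariant_prob_def)
qed

end

section \<open>Gibbs measures of potentials of two coordinates\<close>

text \<open>The Cauchy-Schwarz inequality in fraction form. As division by 0 yields 0, a vanishing
  denominator must come with a vanishing numerator.\<close>

lemma sum_square_div_le:
  fixes a b x y :: real
  assumes "0 \<le> a" "0 \<le> b" "a = 0 \<Longrightarrow> x = 0" "b = 0 \<Longrightarrow> y = 0"
  shows "(x + y)\<^sup>2 / (a + b) \<le> x\<^sup>2 / a + y\<^sup>2 / b"
proof (cases "a = 0 \<or> b = 0")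
  case True
  then show ?thesis using assms by auto
next
  case False
  then have pos: "0 < a" "0 < b" using assms by auto
  have "(x\<^sup>2 / a + y\<^sup>2 / b) * (a + b) - (x + y)\<^sup>2 = (b * x - a * y)\<^sup>2 / (a * b)"
    using pos by (simp add: field_simps power2_eq_square)
  also have "\<dots> \<ge> 0" using pos by simp
  finally show ?thesis using pos by (simp add: pos_divide_le_eq)
qed

lemma finite_positive_bounds:
  fixes S :: "real set"
  assumes "finite S" "\<And>x. x \<in> S \<Longrightarrow> 0 < x"
  obtains C where "0 < C" "\<And>x. x \<in> S \<Longrightarrow> inverse C \<le> x" "\<And>x. x \<in> S \<Longrightarrow> x \<le> C"
proof
  let ?C = "1 + (\<Sum>x\<in>S. x + inverse x)"
  have "0 \<le> (\<Sum>x\<in>S. x + inverse x)"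
    by (intro sum_nonneg) (use assms in \<open>auto simp: less_imp_le\<close>)
  then show C: "0 < ?C" by simp
  have le: "x + inverse x \<le> ?C" if "x \<in> S" for x
  proof -
    have "x + inverse x \<le> (\<Sum>x\<in>S. x + inverse x)"
      by (intro member_le_sum) (use that assms in \<open>auto simp: less_imp_le\<close>)
    then show ?thesis by simp
  qed
  show "x \<le> ?C" if "x \<in> S" for x
    using le[OF that] assms(2)[OF that] positive_imp_inverse_positive[of x] by linarith
  show "inverse ?C \<le> x" if "x \<in> S" for x
  proof -
    have "inverse x \<le> ?C"
      using le[OF that] assms(2)[OF that] by linarith
    then have "inverse ?C \<le> inverse (inverse x)"
      using assms(2)[OF that] by (intro le_imp_inverse_le) auto
    then show ?thesis by simp
  qed
qed

lemma exp_growth_zero: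
  assumes K: "\<And>n. 1 \<le> n \<Longrightarrow> 1 \<le> K * exp (real n * d)"
  shows "0 \<le> (d::real)"
proof (rule ccontr)
  assume "\<not> 0 \<le> d"
  then have "(\<lambda>n. K * exp (real n * d)) \<longlonglongrightarrow> 0"
    by real_asymp
  then have "\<forall>\<^sub>F n in sequentially. K * exp (real n * d) < 1"
    by (rule order_tendstoD) simp
  then have "\<forall>\<^sub>F n in sequentially. K * exp (real n * d) < 1 \<and> 1 \<le> n"
    using eventually_ge_at_top by (rule eventually_conj)
  then show False using K by (fastforce simp: eventually_sequentially)
qed

context golden_mean_shift
begin

text \<open>
  The chi-square divergence of the \<open>n\<close>-marginals of \<open>\<nu>\<close> from the Markov ones is bounded in \<open>n\<close>,
  and invariance makes its increments nondecreasing; hence they vanish, which forces \<open>\<nu>\<close> to have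
  the Markov transition probabilities.
\<close>

lemma markov_measure_unique:
  assumes p: "0 < p" "p < 1" and inv: "invariant_prob A \<nu>"
    and le: "\<And>u. set u \<subseteq> {i, j} \<Longrightarrow> u \<noteq> [] \<Longrightarrow> measure \<nu> (word_cylinder A u) \<le> K * weight p u"
  shows "\<nu> = markov_measure p"
proof -
  interpret prob_space \<nu> using inv by (simp add: invariant_prob_def)
  interpret M: prob_space "markov_measure p" by (rule prob_space_markov_measure)
  have S: "sets \<nu> = sets (shift_borel A)" using inv by (simp add: invariant_prob_def)
  define N where "N u = measure \<nu> (word_cylinder A u)" for u
  have N_nonneg: "0 \<le> N u" for u by (simp add: N_def)
  have N_snoc: "N u = N (u @ [i]) + N (u @ [j])" for u
    unfolding N_def by (rule prob_measure_append[OF prob_space_axioms S])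
  have N_Cons: "N u = N (i # u) + N (j # u)" for u
    unfolding N_def by (rule invariant_measure_Cons[OF inv])
  have N_jj: "N (u @ [j, j]) = 0" for u
    unfolding N_def by (subst word_cylinder_empty_jj[of "length u"]) (auto simp: nth_append)
  have N_ji: "N (u @ [j, i]) = N (u @ [j])" for u
    using N_snoc[of "u @ [j]"] N_jj[of u] by simp
  have W_nonneg: "0 \<le> weight p u" if "set u \<subseteq> {i, j}" for u
    using measure_markov_measure[OF p that] by (metis measure_nonneg)
  have N_sum: "(\<Sum>u\<in>words n. N u) = 1" for n
    unfolding N_def by (rule sum_measure_words[OF prob_space_axioms S])
  \<comment> \<open>The defect of the Markov property after \<open>u\<close> and \<open>i\<close>;
    after \<open>j\<close> the next letter is forced, so there are no other defects. Below,
    \<open>T n\<close> is the weighted square norm of the defects and \<open>Q n\<close> is 1 plus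
    the chi-square divergence of the \<open>n\<close>-marginals.\<close>
  define \<epsilon> where "\<epsilon> u = N (u @ [i, j]) - (1 - p) * N (u @ [i])" for u
  define T where "T n = (\<Sum>u\<in>words n. (\<epsilon> u)\<^sup>2 / weight p (u @ [i]))" for n
  define Q where "Q n = (\<Sum>u\<in>words n. (N u)\<^sup>2 / weight p u)" for n
  have \<epsilon>_zero: "\<epsilon> u = 0" if "set u \<subseteq> {i, j}" "weight p (u @ [i]) = 0" for u
  proof -
    have "N (u @ [i]) = 0"
      using le[of "u @ [i]"] that by (simp add: N_def order.antisym)
    moreover have "N (u @ [i, j]) \<le> N (u @ [i])"
      using N_snoc[of "u @ [i]"] N_nonneg[of "u @ [i, i]"] by simp
    ultimately show ?thesis using N_nonneg[of "u @ [i, j]"] by (simp add: \<epsilon>_def)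
  qed
  \<comment> \<open>Domination by \<open>K * weight p u\<close> bounds each summand by
    \<open>K * N u\<close>. It is assumed for nonempty words only, hence
    \<open>Suc n\<close>.\<close>
  have Q_le: "Q (Suc n) \<le> K" for n
  proof -
    have "Q (Suc n) \<le> (\<Sum>u\<in>words (Suc n). K * N u)"
      unfolding Q_def
    proof (rule sum_mono)
      fix u assume u: "u \<in> words (Suc n)"
      then have su: "set u \<subseteq> {i, j}" "u \<noteq> []" by (auto simp: words_def)
      show "(N u)\<^sup>2 / weight p u \<le> K * N u"
      proof (cases "weight p u = 0")
        case True
        then have "N u = 0" using le[OF su] by (simp add: N_def order.antisym)
        then show ?thesis by simp
      next
        case False
        then have "0 < weight p u" using W_nonneg[OF su(1)] by simp
        moreover have "N u * N u \<le> N u * (K * weight p u)"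
          using le[OF su] N_nonneg[of u] by (intro mult_left_mono) (auto simp: N_def)
        ultimately show ?thesis by (simp add: pos_divide_le_eq power2_eq_square mult_ac)
      qed
    qed
    also have "\<dots> = K" by (simp add: N_sum flip: sum_distrib_left)
    finally show ?thesis .
  qed
  \<comment> \<open>Words ending in \<open>j\<close> have one extension and keep their summand. For
    words ending in \<open>i\<close> the cross terms of the two extensions cancel, and 1 / p + 1 /
    (1 - p) = 1 / (p * (1 - p)) is the coefficient of the squared defect.\<close>
  have Q_step: "Q (Suc (Suc n)) = Q (Suc n) + T n / (p * (1 - p))" for n
  proof -
    have "Q (Suc (Suc n)) = (\<Sum>u\<in>words n. (N (u @ [i, i]))\<^sup>2 / weight p (u @ [i, i]) +
        (N (u @ [i, j]))\<^sup>2 / weight p (u @ [i, j]) +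
        ((N (u @ [j, i]))\<^sup>2 / weight p (u @ [j, i]) + (N (u @ [j, j]))\<^sup>2 / weight p (u @ [j, j])))"
      by (simp add: Q_def sum_words_Suc')
    also have "\<dots> = (\<Sum>u\<in>words n. ((N (u @ [i]))\<^sup>2 / weight p (u @ [i]) + (N (u @ [j]))\<^sup>2 / weight p (u @ [j])) +
        (\<epsilon> u)\<^sup>2 / weight p (u @ [i]) / (p * (1 - p)))"
    proof (rule sum.cong[OF refl])
      fix u assume "u \<in> words n"
      define x where "x = N (u @ [i])"
      define w where "w = weight p (u @ [i])"
      have ij: "N (u @ [i, j]) = (1 - p) * x + \<epsilon> u" by (simp add: \<epsilon>_def x_def)
      have ii: "N (u @ [i, i]) = p * x - \<epsilon> u"
        using N_snoc[of "u @ [i]"] ij by (simp add: x_def algebra_simps)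
      have "(p * x - \<epsilon> u)\<^sup>2 / (w * p) + ((1 - p) * x + \<epsilon> u)\<^sup>2 / (w * (1 - p)) =
          x\<^sup>2 / w + (\<epsilon> u)\<^sup>2 / w / (p * (1 - p))"
      proof (cases "w = 0")
        case False
        then show ?thesis using p by (simp add: divide_simps) (simp add: power2_eq_square algebra_simps)
      qed simp
      then show "(N (u @ [i, i]))\<^sup>2 / weight p (u @ [i, i]) +
        (N (u @ [i, j]))\<^sup>2 / weight p (u @ [i, j]) +
        ((N (u @ [j, i]))\<^sup>2 / weight p (u @ [j, i]) + (N (u @ [j, j]))\<^sup>2 / weight p (u @ [j, j])) =
        ((N (u @ [i]))\<^sup>2 / weight p (u @ [i]) + (N (u @ [j]))\<^sup>2 / weight p (u @ [j])) +
        (\<epsilon> u)\<^sup>2 / weight p (u @ [i]) / (p * (1 - p))"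
        unfolding ii ij N_ji N_jj weight_snoc x_def[symmetric] w_def[symmetric]
        using neq by (simp add: step_def)
    qed
    also have "\<dots> = Q (Suc n) + T n / (p * (1 - p))"
      unfolding sum.distrib by (simp add: Q_def T_def sum_words_Suc' sum.distrib sum_divide_distrib)
    finally show ?thesis .
  qed
  \<comment> \<open>Invariance makes the defects additive under prepending a letter, and the weights
    are additive as well, so \<open>sum_square_div_le\<close> applies word by word.\<close>
  have T_mono: "T n \<le> T (Suc n)" for n
    unfolding T_def sum_words_Suc
  proof (rule sum_mono)
    fix u assume u: "u \<in> words n"
    then have su: "set u \<subseteq> {i, j}" by (simp add: words_def)
    have hd: "hd (u @ [i]) \<in> {i, j}" using su by (cases u) auto
    have "\<epsilon> u = \<epsilon> (i # u) + \<epsilon> (j # u)"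
      unfolding \<epsilon>_def using N_Cons[of "u @ [i, j]"] N_Cons[of "u @ [i]"] by (simp add: algebra_simps)
    moreover have "weight p (u @ [i]) = weight p ((i # u) @ [i]) + weight p ((j # u) @ [i])"
      using weight_Cons_sum[of "u @ [i]"] hd by simp
    ultimately show "(\<epsilon> u)\<^sup>2 / weight p (u @ [i]) \<le>
        (\<epsilon> (i # u))\<^sup>2 / weight p ((i # u) @ [i]) + (\<epsilon> (j # u))\<^sup>2 / weight p ((j # u) @ [i])"
      using su by (simp only:) (intro sum_square_div_le W_nonneg \<epsilon>_zero; simp)
  qed
  have T_nonneg: "0 \<le> T n" for n
    unfolding T_def by (intro sum_nonneg divide_nonneg_nonneg W_nonneg) (auto simp: words_def)
  have T_zero: "T m = 0" for m
  proof (rule ccontr)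
    assume "T m \<noteq> 0"
    define c where "c = T m / (p * (1 - p))"
    have "0 < c" using \<open>T m \<noteq> 0\<close> T_nonneg[of m] p by (simp add: c_def)
    have grow: "real n * c \<le> Q (Suc (m + n))" for n
    proof (induction n)
      case 0
      show ?case unfolding Q_def
        by (auto intro!: sum_nonneg divide_nonneg_nonneg W_nonneg simp: words_def)
    next
      case (Suc n)
      have "T m \<le> T (m + n)"
        by (rule lift_Suc_mono_le[of T]) (use T_mono in auto)
      then have "c \<le> T (m + n) / (p * (1 - p))"
        unfolding c_def using p by (intro divide_right_mono) auto
      then show ?case
        using Suc Q_step[of "m + n"] by (simp add: algebra_simps)
    qed
    obtain n where "K < real n * c"
      using reals_Archimedean3[OF \<open>0 < c\<close>] by blast
    then show False using grow[of n] Q_le[of "m + n"] by simp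
  qed
  have \<epsilon>0: "\<epsilon> u = 0" if su: "set u \<subseteq> {i, j}" for u
  proof -
    have "(\<epsilon> u)\<^sup>2 / weight p (u @ [i]) = 0"
      using T_zero[of "length u"] su unfolding T_def
      by (subst (asm) sum_nonneg_eq_0_iff[OF finite_words])
         (auto simp: words_def intro!: divide_nonneg_nonneg W_nonneg)
    then show ?thesis using \<epsilon>_zero[OF su] by auto
  qed
  have N_ij: "N (u @ [i, j]) = (1 - p) * N (u @ [i])" if "set u \<subseteq> {i, j}" for u
    using \<epsilon>0[OF that] by (simp add: \<epsilon>_def)
  have N_ii: "N (u @ [i, i]) = p * N (u @ [i])" if "set u \<subseteq> {i, j}" for u
    using N_ij[OF that] N_snoc[of "u @ [i]"] by (simp add: algebra_simps)
  have N_weight: "N u = weight p u" if "set u \<subseteq> {i, j}" for u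
    using that
  proof (induction u rule: rev_induct)
    case Nil
    then show ?case using N_sum[of 0] by simp
  next
    case (snoc t u)
    show ?case
    proof (cases u rule: rev_cases)
      case Nil
      \<comment> \<open>The initial law comes from invariance: \<open>[j, j]\<close> is null, so
        \<open>[j]\<close> and \<open>[i, j]\<close> have the same mass.\<close>
      have Nj: "N [j] = (1 - p) * N [i]"
        using N_Cons[of "[j]"] N_jj[of "[]"] N_ij[of "[]"] by simp
      moreover have "N [i] + N [j] = 1"
        using N_sum[of 1] by (simp add: sum_words_Suc)
      ultimately have "N [i] * (2 - p) = 1" by (simp add: algebra_simps)
      then have "N [i] = 1 / (2 - p)" using p by (simp add: field_simps)
      then show ?thesis
        using Nj Nil snoc.prems neq by (auto simp: stationary_def)
    next
      case (snoc v s)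
      then have "N (v @ [s]) = weight p (v @ [s])" and "set v \<subseteq> {i, j}" "s \<in> {i, j}" "t \<in> {i, j}"
        using snoc.IH snoc.prems by auto
      then show ?thesis
        using neq N_ii[of v] N_ij[of v] N_ji[of v] N_jj[of v]
        by (auto simp: snoc weight_snoc step_def)
    qed
  qed
  show ?thesis
  proof (rule shift_measure_eqI[OF S])
    fix u
    show "emeasure \<nu> (word_cylinder A u) = emeasure (markov_measure p) (word_cylinder A u)"
    proof (cases "set u \<subseteq> {i, j}")
      case True
      then show ?thesis
        using N_weight[OF True] by (simp add: emeasure_markov_measure[OF p] emeasure_eq_measure N_def)
    next
      case False
      then show ?thesis by (subst (1 2) word_cylinder_empty) (auto simp: words_def)
    qed
  qed auto
qed

section \<open>Existence of a Markov Gibbs measure\<close>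

lemma locally_constant_2_eq:
  assumes "f \<in> locally_constant 2 A"
  shows "\<exists>F. \<forall>\<omega>\<in>markov_shift A. f \<omega> = F (\<omega> 0) (\<omega> 1)"
proof (intro exI ballI)
  fix \<omega> assume \<omega>: "\<omega> \<in> markov_shift A"
  let ?\<omega> = "SOME \<omega>'. \<omega>' \<in> markov_shift A \<and> \<omega>' 0 = \<omega> 0 \<and> \<omega>' 1 = \<omega> 1"
  have "?\<omega> \<in> markov_shift A \<and> ?\<omega> 0 = \<omega> 0 \<and> ?\<omega> 1 = \<omega> 1"
    by (rule someI[of _ \<omega>]) (use \<omega> in auto)
  moreover from this have "\<forall>k<2. \<omega> k = ?\<omega> k"
    by (simp add: less_2_cases_iff)
  ultimately have "f \<omega> = f ?\<omega>"
    using assms \<omega> unfolding locally_constant_def by blast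
  then show "f \<omega> = (\<lambda>s t. f (SOME \<omega>'. \<omega>' \<in> markov_shift A \<and> \<omega>' 0 = s \<and> \<omega>' 1 = t)) (\<omega> 0) (\<omega> 1)"
    by simp
qed

lemma weight_prefix:
  "weight p (map \<omega> [0..<Suc n]) = stationary p (\<omega> 0) * (\<Prod>k<n. step p (\<omega> k) (\<omega> (Suc k)))"
proof (induction n)
  case (Suc n)
  have "weight p (map \<omega> [0..<Suc (Suc n)]) = weight p (map \<omega> [0..<Suc n]) * step p (\<omega> n) (\<omega> (Suc n))"
    using weight_snoc[of p "map \<omega> [0..<n]" "\<omega> n" "\<omega> (Suc n)"] by simp
  then show ?case unfolding Suc by simp
qed simp

lemma transition_cases:
  assumes "\<omega> \<in> markov_shift A"
  obtains "\<omega> k = i" "\<omega> (Suc k) = i" | "\<omega> k = i" "\<omega> (Suc k) = j" | "\<omega> k = j" "\<omega> (Suc k) = i"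
proof -
  have "\<omega> k \<in> {i, j}" "\<omega> (Suc k) \<in> {i, j}" "\<omega> k = j \<longrightarrow> \<omega> (Suc k) = i"
    using assms unfolding markov_shift_eq by blast+
  then show ?thesis using that by blast
qed

text \<open>The potential gives the positive matrix with rows (exp a, exp b) and (exp c, 0).
  Normalizing it by its leading eigenvalue and the corresponding eigenvector turns it into a
  stochastic matrix, which is \<open>step p\<close> for a suitable \<open>p\<close>.\<close>

lemma markov_measure_is_gibbs:
  assumes f: "f \<in> locally_constant 2 A"
  obtains p where "0 < p" "p < 1" "is_gibbs_measure A f (markov_measure p)"
proof -
  obtain F where F: "\<And>\<omega>. \<omega> \<in> markov_shift A \<Longrightarrow> f \<omega> = F (\<omega> 0) (\<omega> 1)"
    using locally_constant_2_eq[OF f] by blast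
  define a b c where "a = F i i" and "b = F i j" and "c = F j i"
  \<comment> \<open>The characteristic equation of that matrix for the inverse \<open>t\<close> of
    the eigenvalue. The left-hand side is 0 at \<open>t = 0\<close> and exceeds 1 at
    \<open>t = exp (- a)\<close>.\<close>
  have "\<exists>t\<ge>0. t \<le> exp (- a) \<and> exp a * t + exp (b + c) * t\<^sup>2 = 1"
    by (rule IVT') (auto intro!: continuous_intros simp flip: exp_add)
  then obtain t where t: "0 \<le> t" "exp a * t + exp (b + c) * t\<^sup>2 = 1" by blast
  then have "0 < t" by (cases "t = 0") auto
  define p where "p = exp a * t"
  define P where "P = - ln t"
  have p: "0 < p" "p < 1"
    using t \<open>0 < t\<close> by (auto simp: p_def) (smt (verit) exp_gt_zero mult_pos_pos zero_less_power)
  have tP: "t = exp (- P)" using \<open>0 < t\<close> by (simp add: P_def)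
  \<comment> \<open>The logarithm of the eigenvector, chosen so that the transition from
    \<open>j\<close> to \<open>i\<close> gets probability 1.\<close>
  define h where "h s = (if s = i then 0 else P - c)" for s
  have "1 - p = exp (b + c - 2 * P)"
    using t(2) by (simp add: p_def tP power2_eq_square flip: exp_add)
  moreover have "p = exp (a - P)" by (simp add: p_def tP flip: exp_add)
  ultimately have step_eq: "step p (\<omega> k) (\<omega> (Suc k)) = exp (F (\<omega> k) (\<omega> (Suc k)) - P + h (\<omega> k) - h (\<omega> (Suc k)))"
    if "\<omega> \<in> markov_shift A" for \<omega> k
    using transition_cases[OF that, of k]
    by cases (use neq in \<open>auto simp: step_def h_def a_def b_def c_def\<close>)
  \<comment> \<open>A cylinder of length \<open>n\<close> fixes \<open>n - 1\<close> transitions,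
    whereas the Birkhoff sum has \<open>n\<close> terms. After telescoping \<open>h\<close>, the
    Gibbs ratio depends only on the first symbol and on the last transition of the sum, so it takes
    finitely many values.\<close>
  define R where "R = (\<lambda>(r, s, t). stationary p r * exp (h r - h s + P - F s t))"
  obtain C where C: "0 < C" "\<And>x. x \<in> R ` ({i, j} \<times> {i, j} \<times> {i, j}) \<Longrightarrow> inverse C \<le> x"
      "\<And>x. x \<in> R ` ({i, j} \<times> {i, j} \<times> {i, j}) \<Longrightarrow> x \<le> C"
    by (rule finite_positive_bounds[of "R ` ({i, j} \<times> {i, j} \<times> {i, j})"])
       (use p in \<open>auto simp: R_def stationary_def\<close>)
  have ratio: "measure (markov_measure p) (cylinder A n \<omega>) / exp (- real n * P + (\<Sum>k<n. f ((shift_map ^^ k) \<omega>)))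
      \<in> R ` ({i, j} \<times> {i, j} \<times> {i, j})" if \<omega>: "\<omega> \<in> markov_shift A" and n: "1 \<le> n" for \<omega> n
  proof -
    obtain m where m: "n = Suc m" using n by (cases n) auto
    have mem: "\<omega> k \<in> {i, j}" for k using \<omega> by (auto simp: markov_shift_eq)
    have "(\<lambda>n. \<omega> (n + k)) \<in> markov_shift A" for k
      using \<omega> by (auto simp: markov_shift_eq)
    then have fk: "f ((shift_map ^^ k) \<omega>) = F (\<omega> k) (\<omega> (Suc k))" for k
      unfolding shift_map_funpow by (subst F) auto
    have "(\<Prod>k<m. step p (\<omega> k) (\<omega> (Suc k))) = exp (\<Sum>k<m. F (\<omega> k) (\<omega> (Suc k)) - P + h (\<omega> k) - h (\<omega> (Suc k)))"
      by (simp add: exp_sum step_eq[OF \<omega>])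
    also have "(\<Sum>k<m. F (\<omega> k) (\<omega> (Suc k)) - P + h (\<omega> k) - h (\<omega> (Suc k))) =
        (\<Sum>k<m. F (\<omega> k) (\<omega> (Suc k))) - real m * P + (h (\<omega> 0) - h (\<omega> m))"
      by (induction m) (auto simp: algebra_simps)
    finally have W: "weight p (map \<omega> [0..<n]) =
        stationary p (\<omega> 0) * exp ((\<Sum>k<m. F (\<omega> k) (\<omega> (Suc k))) - real m * P + (h (\<omega> 0) - h (\<omega> m)))"
      unfolding m weight_prefix by simp
    let ?S = "\<Sum>k<m. F (\<omega> k) (\<omega> (Suc k))"
    have "measure (markov_measure p) (cylinder A n \<omega>) = weight p (map \<omega> [0..<n])"
      unfolding cylinder_eq_word_cylinder
      by (rule measure_markov_measure[OF p]) (use mem in auto)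
    then have "measure (markov_measure p) (cylinder A n \<omega>) / exp (- real n * P + (\<Sum>k<n. f ((shift_map ^^ k) \<omega>)))
        = stationary p (\<omega> 0) * (exp (?S - real m * P + (h (\<omega> 0) - h (\<omega> m))) /
            exp (- real (Suc m) * P + (?S + F (\<omega> m) (\<omega> (Suc m)))))"
      unfolding fk W by (simp add: m)
    also have "\<dots> = R (\<omega> 0, \<omega> m, \<omega> n)"
      unfolding exp_diff[symmetric] by (simp add: R_def m algebra_simps)
    finally have "measure (markov_measure p) (cylinder A n \<omega>) / exp (- real n * P + (\<Sum>k<n. f ((shift_map ^^ k) \<omega>)))
        = R (\<omega> 0, \<omega> m, \<omega> n)" .
    then show ?thesis using mem[of 0] mem[of m] mem[of n] by (intro image_eqI[of _ _ "(\<omega> 0, \<omega> m, \<omega> n)"]) blast+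
  qed
  have "is_gibbs_measure A f (markov_measure p)"
    unfolding is_gibbs_measure_def
    using continuous_map_locally_constant[OF f] invariant_markov_measure[OF p] C(1)
    by (intro conjI exI[of _ C] exI[of _ P] ballI allI impI C(2,3) ratio) auto
  then show ?thesis using that p by blast
qed

text \<open>The Birkhoff sums of the common potential cancel, which leaves the difference
  \<open>d\<close> of the two constants \<open>P\<close>; it occurs with opposite signs in the two
  directions.\<close>

lemma gibbs_compare:
  assumes "is_gibbs_measure A f \<mu>" "is_gibbs_measure A f \<nu>"
  obtains K d where "\<And>u. u \<noteq> [] \<Longrightarrow> measure \<nu> (word_cylinder A u) \<le> K * exp (real (length u) * d) * measure \<mu> (word_cylinder A u)"
    "\<And>u. u \<noteq> [] \<Longrightarrow> measure \<mu> (word_cylinder A u) \<le> K * exp (real (length u) * (- d)) * measure \<nu> (word_cylinder A u)"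
proof -
  obtain C P where C: "0 < C" and \<mu>: "\<And>\<omega> n. \<omega> \<in> markov_shift A \<Longrightarrow> 1 \<le> n \<Longrightarrow>
        inverse C \<le> measure \<mu> (cylinder A n \<omega>) / exp (- real n * P + (\<Sum>k<n. f ((shift_map ^^ k) \<omega>))) \<and>
        measure \<mu> (cylinder A n \<omega>) / exp (- real n * P + (\<Sum>k<n. f ((shift_map ^^ k) \<omega>))) \<le> C"
    using assms(1) unfolding is_gibbs_measure_def by blast
  obtain C' P' where C': "0 < C'" and \<nu>: "\<And>\<omega> n. \<omega> \<in> markov_shift A \<Longrightarrow> 1 \<le> n \<Longrightarrow>
        inverse C' \<le> measure \<nu> (cylinder A n \<omega>) / exp (- real n * P' + (\<Sum>k<n. f ((shift_map ^^ k) \<omega>))) \<and>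
        measure \<nu> (cylinder A n \<omega>) / exp (- real n * P' + (\<Sum>k<n. f ((shift_map ^^ k) \<omega>))) \<le> C'"
    using assms(2) unfolding is_gibbs_measure_def by blast
  have *: "y \<le> C * C' * exp (n * (P - P')) * x"
    if "inverse C \<le> x / exp (- n * P + s)" "y / exp (- n * P' + s) \<le> C'" "0 < C" "0 < C'"
    for x y s n P P' C C' :: real
  proof -
    have "exp (- n * P + s) \<le> C * x"
      using that by (simp add: field_simps)
    then have "C' * exp (n * (P - P')) * exp (- n * P + s) \<le> C' * exp (n * (P - P')) * (C * x)"
      using that by (intro mult_left_mono) auto
    moreover have "exp (n * (P - P')) * exp (- n * P + s) = exp (- n * P' + s)"
      by (simp add: algebra_simps flip: exp_add)
    moreover have "y \<le> C' * exp (- n * P' + s)"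
      using that by (simp add: field_simps)
    ultimately show ?thesis by (simp add: algebra_simps)
  qed
  show ?thesis
  proof (rule that)
    fix u :: "nat list" assume "u \<noteq> []"
    then have n: "1 \<le> length u" by (cases u) auto
    have "measure \<nu> (word_cylinder A u) \<le> C * C' * exp (real (length u) * (P - P')) * measure \<mu> (word_cylinder A u) \<and>
        measure \<mu> (word_cylinder A u) \<le> C * C' * exp (real (length u) * (- (P - P'))) * measure \<nu> (word_cylinder A u)"
    proof (cases "word_cylinder A u = {}")
      case False
      then obtain \<omega> where \<omega>: "\<omega> \<in> word_cylinder A u" by blast
      then have "\<omega> \<in> markov_shift A" by (simp add: word_cylinder_def)
      then show ?thesis
        using *[of C "measure \<mu> (word_cylinder A u)" "length u" P "\<Sum>k<length u. f ((shift_map ^^ k) \<omega>)" "measure \<nu> (word_cylinder A u)" P' C']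
          *[of C' "measure \<nu> (word_cylinder A u)" "length u" P' "\<Sum>k<length u. f ((shift_map ^^ k) \<omega>)" "measure \<mu> (word_cylinder A u)" P C]
          \<mu>[of \<omega> "length u"] \<nu>[of \<omega> "length u"] n C C'
        unfolding word_cylinder_eq_cylinder[OF \<omega>] by (simp add: mult.commute)
    qed simp
    then show "measure \<nu> (word_cylinder A u) \<le> C * C' * exp (real (length u) * (P - P')) * measure \<mu> (word_cylinder A u)"
      "measure \<mu> (word_cylinder A u) \<le> C * C' * exp (real (length u) * (- (P - P'))) * measure \<nu> (word_cylinder A u)"
      by blast+
  qed
qed

text \<open>Summing over all words of length n gives 1 \<le> K * exp (n * d) for every n \<ge> 1.
  Used in both directions, this makes the two pressure constants equal.\<close>

lemma gibbs_compare_nonneg: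
  assumes "invariant_prob A \<mu>" "invariant_prob A \<nu>"
    and "\<And>u. u \<noteq> [] \<Longrightarrow> measure \<nu> (word_cylinder A u) \<le> K * exp (real (length u) * d) * measure \<mu> (word_cylinder A u)"
  shows "0 \<le> d"
proof (rule exp_growth_zero)
  fix n :: nat assume n: "1 \<le> n"
  have "1 = (\<Sum>u\<in>words n. measure \<nu> (word_cylinder A u))"
    using assms(2) by (simp add: sum_measure_words invariant_prob_def)
  also have "\<dots> \<le> (\<Sum>u\<in>words n. K * exp (real n * d) * measure \<mu> (word_cylinder A u))"
  proof (rule sum_mono)
    fix u assume "u \<in> words n"
    then show "measure \<nu> (word_cylinder A u) \<le> K * exp (real n * d) * measure \<mu> (word_cylinder A u)"
      using assms(3)[of u] n by (cases "u = []") (auto simp: words_def)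
  qed
  also have "\<dots> = K * exp (real n * d)"
    using assms(1) by (simp add: sum_measure_words invariant_prob_def flip: sum_distrib_left)
  finally show "1 \<le> K * exp (real n * d)" .
qed

lemma gibbs_measure_markov:
  assumes f: "f \<in> locally_constant 2 A"
  obtains p where "0 < p" "p < 1" "gibbs_measure A f = markov_measure p"
proof -
  obtain p where p: "0 < p" "p < 1" and G: "is_gibbs_measure A f (markov_measure p)"
    by (rule markov_measure_is_gibbs[OF f])
  have "\<nu> = markov_measure p" if H: "is_gibbs_measure A f \<nu>" for \<nu>
  proof -
    have inv: "invariant_prob A \<nu>" using H by (simp add: is_gibbs_measure_def)
    obtain K d where K: "\<And>u. u \<noteq> [] \<Longrightarrow> measure \<nu> (word_cylinder A u) \<le>
          K * exp (real (length u) * d) * measure (markov_measure p) (word_cylinder A u)"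
      "\<And>u. u \<noteq> [] \<Longrightarrow> measure (markov_measure p) (word_cylinder A u) \<le>
          K * exp (real (length u) * (- d)) * measure \<nu> (word_cylinder A u)"
      using gibbs_compare[OF G H] by blast
    have "0 \<le> d"
      by (rule gibbs_compare_nonneg[OF invariant_markov_measure[OF p] inv K(1)])
    moreover have "0 \<le> - d"
      by (rule gibbs_compare_nonneg[OF inv invariant_markov_measure[OF p] K(2)])
    ultimately have "d = 0" by simp
    show ?thesis
    proof (rule markov_measure_unique[OF p inv])
      fix u assume "set u \<subseteq> {i, j}" "u \<noteq> []"
      then show "measure \<nu> (word_cylinder A u) \<le> K * weight p u"
        using K(1)[of u] measure_markov_measure[OF p, of u] \<open>d = 0\<close> by simp
    qed
  qed
  then have "gibbs_measure A f = markov_measure p"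
    unfolding gibbs_measure_def using G by blast
  then show ?thesis using that p by blast
qed

end

section \<open>Isomorphisms\<close>

text \<open>Taken relative to \<open>X\<close>, so that a conjugacy defined only on \<open>X\<close>
  preserves the notion exactly.\<close>

definition branch_points :: "(nat \<Rightarrow> nat) set \<Rightarrow> (nat \<Rightarrow> nat) set" where
  "branch_points X = {\<omega> \<in> X. \<exists>\<omega>'\<in>X. \<omega>' \<noteq> \<omega> \<and> shift_map \<omega>' = shift_map \<omega>}"

text \<open>Equality of shift images is reflected by \<Phi> because these images stay in
  \<open>X\<close>, where \<Phi> is injective.\<close>

lemma branch_points_image:
  assumes bij: "bij_betw \<Phi> X Y" and X: "shift_map ` X \<subseteq> X"
    and comm: "\<And>\<omega>. \<omega> \<in> X \<Longrightarrow> \<Phi> (shift_map \<omega>) = shift_map (\<Phi> \<omega>)"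
  shows "\<Phi> ` branch_points X = branch_points Y"
proof -
  have "shift_map \<omega>' = shift_map \<omega> \<longleftrightarrow> shift_map (\<Phi> \<omega>') = shift_map (\<Phi> \<omega>)"
    and "\<omega>' \<noteq> \<omega> \<longleftrightarrow> \<Phi> \<omega>' \<noteq> \<Phi> \<omega>" if "\<omega> \<in> X" "\<omega>' \<in> X" for \<omega> \<omega>'
    using that bij X unfolding bij_betw_def comm[OF that(1), symmetric] comm[OF that(2), symmetric]
    by (auto simp: inj_on_eq_iff image_subset_iff)
  moreover have "Y = \<Phi> ` X" using bij by (simp add: bij_betw_def)
  ultimately show ?thesis
    unfolding branch_points_def by fast
qed

lemma mem_word_cylinder_Cons:
  "\<omega> \<in> word_cylinder A (s # u) \<longleftrightarrow>
    \<omega> \<in> markov_shift A \<and> \<omega> 0 = s \<and> shift_map \<omega> \<in> word_cylinder A u"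
proof -
  have "(\<forall>k<Suc (length u). \<omega> k = (s # u) ! k) \<longleftrightarrow> \<omega> 0 = s \<and> (\<forall>k<length u. \<omega> (Suc k) = u ! k)"
    unfolding All_less_Suc2 by simp
  then show ?thesis
    using shift_map_markov_shift[of \<omega> A] by (auto simp: mem_word_cylinder shift_map_def)
qed

lemma shift_isomorphic_refl:
  assumes "prob_space \<mu>" "sets \<mu> = sets (shift_borel A)"
  shows "shift_isomorphic A \<mu> \<mu>"
proof -
  interpret prob_space \<mu> by fact
  have sp: "space \<mu> = markov_shift A"
    using sets_eq_imp_space_eq[OF assms(2)] by simp
  have top: "markov_shift A \<in> sets (shift_borel A)"
    using sets.top[of "shift_borel A"] by simp
  have inv: "inv_into (markov_shift A) (\<lambda>\<omega>. \<omega>) \<omega> = \<omega>" if "\<omega> \<in> markov_shift A" for \<omega>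
    using inv_into_f_f[of "\<lambda>\<omega>. \<omega>" "markov_shift A" \<omega>] that by (simp add: inj_on_def)
  show ?thesis
    unfolding shift_isomorphic_def
  proof (intro exI conjI)
    show "markov_shift A \<in> sets (shift_borel A)" "markov_shift A \<in> sets (shift_borel A)"
      by (rule top)+
    show "bij_betw (\<lambda>\<omega>. \<omega>) (markov_shift A) (markov_shift A)"
      by (simp add: bij_betw_def)
    show "shift_map ` markov_shift A \<subseteq> markov_shift A" "shift_map ` markov_shift A \<subseteq> markov_shift A"
      by (auto simp: shift_map_markov_shift)
    show "emeasure \<mu> (markov_shift A) = 1" "emeasure \<mu> (markov_shift A) = 1"
      using emeasure_space_1 sp by simp_all
    show "(\<lambda>\<omega>. \<omega>) \<in> measurable (restrict_space (shift_borel A) (markov_shift A))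
        (restrict_space (shift_borel A) (markov_shift A))"
      by simp
    have "(\<lambda>\<omega>. \<omega>) \<in> measurable (restrict_space (shift_borel A) (markov_shift A))
        (restrict_space (shift_borel A) (markov_shift A))"
      by simp
    then show "inv_into (markov_shift A) (\<lambda>\<omega>. \<omega>) \<in> measurable (restrict_space (shift_borel A) (markov_shift A))
        (restrict_space (shift_borel A) (markov_shift A))"
      by (rule measurable_cong[THEN iffD1, rotated]) (simp add: space_restrict_space inv)
  qed auto
qed

context golden_mean_shift
begin

definition other :: "nat \<Rightarrow> nat" where
  "other s = (if s = i then j else i)"

text \<open>The involution exchanging the two preimages of points that start with \<open>i\<close>.\<close>

definition swap :: "(nat \<Rightarrow> nat) \<Rightarrow> nat \<Rightarrow> nat" where
  "swap \<omega> = (if \<omega> 1 = i then fun_upd \<omega> 0 (other (\<omega> 0)) else \<omega>)"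

lemma swap_markov_shift:
  assumes "\<omega> \<in> markov_shift A"
  shows "swap \<omega> \<in> markov_shift A"
  unfolding markov_shift_eq
proof (intro CollectI allI)
  fix n
  show "swap \<omega> n \<in> {i, j} \<and> (swap \<omega> n = j \<longrightarrow> swap \<omega> (Suc n) = i)"
    using transition_cases[OF assms, of n]
    by cases (use neq in \<open>auto simp: swap_def other_def\<close>)
qed

lemma shift_map_swap: "shift_map (swap \<omega>) = shift_map \<omega>"
  by (simp add: swap_def shift_map_def)

lemma measurable_swap [measurable]: "swap \<in> measurable (shift_borel A) (shift_borel A)"
proof (rule measurable_shift_borelI)
  fix k
  have [measurable]: "(\<lambda>\<omega>. other (\<omega> 0)) \<in> measurable (shift_borel A) (count_space UNIV)"
    by (rule measurable_compose[OF measurable_shift_coordinate]) simp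
  have "(\<lambda>\<omega>. swap \<omega> k) = (\<lambda>\<omega>. if \<omega> 1 = i \<and> k = 0 then other (\<omega> 0) else \<omega> k)"
    by (auto simp: swap_def)
  also have "\<dots> \<in> measurable (shift_borel A) (count_space UNIV)"
    by measurable
  finally show "(\<lambda>\<omega>. swap \<omega> k) \<in> measurable (shift_borel A) (count_space UNIV)" .
qed (simp add: swap_markov_shift)

lemma branch_points_eq:
  assumes "X \<subseteq> markov_shift A"
  shows "branch_points X = {\<omega> \<in> X. \<omega> 1 = i \<and> swap \<omega> \<in> X}"
proof (intro equalityI subsetI)
  fix \<omega> assume "\<omega> \<in> branch_points X"
  then obtain \<omega>' where \<omega>: "\<omega> \<in> X" "\<omega>' \<in> X" "\<omega>' \<noteq> \<omega>" "shift_map \<omega>' = shift_map \<omega>"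
    by (auto simp: branch_points_def)
  have Suc_eq: "\<omega>' (Suc n) = \<omega> (Suc n)" for n
    using \<omega>(4) by (simp add: shift_map_def fun_eq_iff)
  have ne: "\<omega>' 0 \<noteq> \<omega> 0"
  proof
    assume "\<omega>' 0 = \<omega> 0"
    then have "\<omega>' n = \<omega> n" for n using Suc_eq by (cases n) auto
    then show False using \<omega>(3) by auto
  qed
  have S: "\<omega> \<in> markov_shift A" "\<omega>' \<in> markov_shift A" using \<omega> assms by auto
  have "\<omega> 1 = i" "\<omega>' 0 = other (\<omega> 0)"
    using transition_cases[OF S(1), of 0] transition_cases[OF S(2), of 0] ne Suc_eq[of 0] neq
    by (auto simp: other_def)
  moreover from this have "\<omega>' = swap \<omega>"
    using Suc_eq by (auto simp: swap_def fun_eq_iff gr0_conv_Suc)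
  ultimately show "\<omega> \<in> {\<omega> \<in> X. \<omega> 1 = i \<and> swap \<omega> \<in> X}"
    using \<omega> by simp
next
  fix \<omega> assume \<omega>: "\<omega> \<in> {\<omega> \<in> X. \<omega> 1 = i \<and> swap \<omega> \<in> X}"
  then have "swap \<omega> 0 \<noteq> \<omega> 0"
    using neq by (auto simp: swap_def other_def)
  then have "swap \<omega> \<noteq> \<omega>" by metis
  then show "\<omega> \<in> branch_points X"
    using \<omega> shift_map_swap[of \<omega>] unfolding branch_points_def by blast
qed

text \<open>The Radon-Nikodym density of the image measure under \<open>swap\<close>: by
  reversibility, coordinate 0 has law \<open>step p i\<close> given that coordinate 1 is
  \<open>i\<close>.\<close>

definition swap_density :: "real \<Rightarrow> (nat \<Rightarrow> nat) \<Rightarrow> real" where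
  "swap_density p \<omega> = (if \<omega> 1 = i then step p i (other (\<omega> 0)) / step p i (\<omega> 0) else 1)"

lemma measurable_swap_density [measurable]: "swap_density p \<in> borel_measurable (shift_borel A)"
proof -
  have [measurable]: "(\<lambda>\<omega>. (g :: nat \<Rightarrow> real) (\<omega> k)) \<in> borel_measurable (shift_borel A)" for g k
    by (rule measurable_compose[OF measurable_shift_coordinate]) simp
  show ?thesis unfolding swap_density_def by measurable
qed

lemma swap_density_word:
  assumes p: "0 < p" "p < 1" and u: "set u \<subseteq> {i, j}" "2 \<le> length u"
  shows "emeasure (distr (markov_measure p) (shift_borel A) swap) (word_cylinder A u) =
    emeasure (density (markov_measure p) (\<lambda>\<omega>. ennreal (swap_density p \<omega>))) (word_cylinder A u)"
proof -
  obtain s t v where uv: "u = s # t # v"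
    using u(2) by (auto simp: Suc_le_length_iff numeral_2_eq_2)
  define c where "c = (if t = i then step p i (other s) / step p i s else 1)"
  \<comment> \<open>The first letter which \<open>swap\<close> turns into \<open>s\<close>.\<close>
  define s' where "s' = (if t = i then other s else s)"
  have st: "s \<in> {i, j}" "t \<in> {i, j}" "set v \<subseteq> {i, j}" "s' \<in> {i, j}"
    using u uv by (auto simp: s'_def other_def)
  have pos: "0 < step p i r" for r using p by (simp add: step_def)
  have "swap -` word_cylinder A u \<inter> markov_shift A = word_cylinder A (s' # t # v)"
    unfolding set_eq_iff
  proof
    fix \<omega>
    show "\<omega> \<in> swap -` word_cylinder A u \<inter> markov_shift A \<longleftrightarrow> \<omega> \<in> word_cylinder A (s' # t # v)"
    proof (cases "\<omega> \<in> markov_shift A \<and> shift_map \<omega> \<in> word_cylinder A (t # v)")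
      case True
      then have "\<omega> 1 = t" "\<omega> 0 \<in> {i, j}"
        by (auto simp: mem_word_cylinder shift_map_def markov_shift_eq)
      then have "swap \<omega> 0 = s \<longleftrightarrow> \<omega> 0 = s'"
        using st(1) neq by (auto simp: swap_def s'_def other_def)
      then show ?thesis
        using True swap_markov_shift[of \<omega>] by (simp add: uv mem_word_cylinder_Cons shift_map_swap)
    qed (auto simp: uv mem_word_cylinder_Cons shift_map_swap)
  qed
  then have "emeasure (distr (markov_measure p) (shift_borel A) swap) (word_cylinder A u) = weight p (s' # t # v)"
    using st by (subst emeasure_distr) (auto simp: emeasure_markov_measure[OF p])
  also have "weight p (s' # t # v) = c * weight p u"
  proof (cases "t = i")
    case True
    then show ?thesis
      using st pos[of s] by (simp add: uv weight_Cons s'_def c_def)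
  next
    case False
    then show ?thesis by (simp add: uv s'_def c_def)
  qed
  also have "ennreal (c * weight p u) = ennreal c * emeasure (markov_measure p) (word_cylinder A u)"
    using u pos by (simp add: emeasure_markov_measure[OF p] c_def less_imp_le ennreal_mult')
  also have "\<dots> = (\<integral>\<^sup>+ \<omega>. ennreal c * indicator (word_cylinder A u) \<omega> \<partial>markov_measure p)"
    by (subst nn_integral_cmult_indicator) auto
  also have "\<dots> = (\<integral>\<^sup>+ \<omega>. ennreal (swap_density p \<omega>) * indicator (word_cylinder A u) \<omega> \<partial>markov_measure p)"
    by (rule nn_integral_cong)
       (auto simp: indicator_def mem_word_cylinder uv swap_density_def c_def nth_Cons dest: spec[of _ 0] spec[of _ 1])
  also have "\<dots> = emeasure (density (markov_measure p) (\<lambda>\<omega>. ennreal (swap_density p \<omega>))) (word_cylinder A u)"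
    by (subst emeasure_density) auto
  finally show ?thesis .
qed

lemma distr_swap_markov_measure:
  assumes p: "0 < p" "p < 1"
  shows "distr (markov_measure p) (shift_borel A) swap =
    density (markov_measure p) (\<lambda>\<omega>. ennreal (swap_density p \<omega>))" (is "?D = ?E")
proof (rule shift_measure_eqI)
  interpret prob_space "markov_measure p" by (rule prob_space_markov_measure)
  interpret D: prob_space ?D by (rule prob_space_distr) simp
  show "emeasure ?D (space ?D) \<noteq> \<infinity>" by simp
  have split: "emeasure N (word_cylinder A u) = emeasure N (word_cylinder A (u @ [i])) + emeasure N (word_cylinder A (u @ [j]))"
    if "sets N = sets (shift_borel A)" for N u
    using that word_cylinder_append[of u] by (simp add: plus_emeasure)
  show "emeasure ?D (word_cylinder A u) = emeasure ?E (word_cylinder A u)" for u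
  proof (cases "set u \<subseteq> {i, j}")
    case True
    show ?thesis
    proof (cases "2 \<le> length u")
      \<comment> \<open>The density depends on two coordinates; appending two letters makes the word
        long enough.\<close>
      case False
      have "emeasure N (word_cylinder A u) = emeasure N (word_cylinder A (u @ [i, i])) + emeasure N (word_cylinder A (u @ [i, j]))
          + (emeasure N (word_cylinder A (u @ [j, i])) + emeasure N (word_cylinder A (u @ [j, j])))"
        if N: "sets N = sets (shift_borel A)" for N
        using split[OF N, of u] split[OF N, of "u @ [i]"] split[OF N, of "u @ [j]"] by simp
      then show ?thesis
        using True by (simp add: swap_density_word[OF p])
    qed (use True swap_density_word[OF p] in auto)
  next
    case False
    then show ?thesis by (subst (1 2) word_cylinder_empty) (auto simp: words_def)
  qed
qed auto

text \<open>Removing a null set from the space could destroy the second preimages of many points. It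
  does not, since the image of the measure under \<open>swap\<close> is absolutely continuous:
  almost every point of \<open>X\<close> is mapped into \<open>X\<close> again.\<close>

lemma emeasure_branch_points:
  assumes p: "0 < p" "p < 1" and X: "X \<in> sets (shift_borel A)" and one: "emeasure (markov_measure p) X = 1"
  shows "branch_points X \<in> sets (shift_borel A)"
    and "emeasure (markov_measure p) (branch_points X) = ennreal (1 / (2 - p))"
proof -
  interpret prob_space "markov_measure p" by (rule prob_space_markov_measure)
  have sub: "X \<subseteq> markov_shift A" using sets.sets_into_space[OF X] by simp
  have "branch_points X = {\<omega> \<in> space (shift_borel A). \<omega> \<in> X \<and> \<omega> 1 = i \<and> swap \<omega> \<in> X}"
    using sub by (auto simp: branch_points_eq)
  also have "\<dots> \<in> sets (shift_borel A)" using X by measurable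
  finally show B: "branch_points X \<in> sets (shift_borel A)" .
  have AE_X: "AE \<omega> in markov_measure p. \<omega> \<in> X"
    using one X by (subst AE_in_set_eq_1) (auto simp: measure_def)
  then have "AE \<omega> in density (markov_measure p) (\<lambda>\<omega>. ennreal (swap_density p \<omega>)). \<omega> \<in> X"
    by (subst AE_density) auto
  then have "AE \<omega> in distr (markov_measure p) (shift_borel A) swap. \<omega> \<in> X"
    by (simp only: distr_swap_markov_measure[OF p])
  then have AE_swap: "AE \<omega> in markov_measure p. swap \<omega> \<in> X"
    by (rule AE_distrD[rotated]) simp
  let ?E = "{\<omega> \<in> markov_shift A. \<omega> 1 = i}"
  \<comment> \<open>This is the event that the shifted point starts with \<open>i\<close>, so
    invariance gives it the stationary mass of \<open>i\<close>.\<close>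
  have E: "?E = shift_map -` word_cylinder A [i] \<inter> space (markov_measure p)"
    by (auto simp: mem_word_cylinder shift_map_def shift_map_markov_shift[unfolded shift_map_def])
  have "emeasure (markov_measure p) (branch_points X) = emeasure (markov_measure p) ?E"
  proof (rule emeasure_eq_AE)
    show "AE \<omega> in markov_measure p. \<omega> \<in> branch_points X \<longleftrightarrow> \<omega> \<in> ?E"
      using AE_X AE_swap by eventually_elim (use sub in \<open>auto simp: branch_points_eq\<close>)
    show "?E \<in> sets (markov_measure p)"
      unfolding E by measurable
  qed (use B in simp)
  also have "\<dots> = emeasure (markov_measure p) (word_cylinder A [i])"
    unfolding E using invariant_markov_measure[OF p] by (simp add: invariant_prob_def)
  also have "\<dots> = ennreal (1 / (2 - p))"
    by (subst emeasure_markov_measure[OF p]) (auto simp: stationary_def)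
  finally show "emeasure (markov_measure p) (branch_points X) = ennreal (1 / (2 - p))" .
qed

lemma shift_isomorphic_markov_measure_iff:
  assumes p: "0 < p" "p < 1" and p': "0 < p'" "p' < 1"
  shows "shift_isomorphic A (markov_measure p) (markov_measure p') \<longleftrightarrow> p = p'"
proof
  assume "shift_isomorphic A (markov_measure p) (markov_measure p')"
  then obtain X Y \<Phi> where H: "X \<in> sets (shift_borel A) \<and> Y \<in> sets (shift_borel A) \<and>
        bij_betw \<Phi> X Y \<and>
        shift_map ` X \<subseteq> X \<and> shift_map ` Y \<subseteq> Y \<and>
        emeasure (markov_measure p) X = 1 \<and> emeasure (markov_measure p') Y = 1 \<and>
        \<Phi> \<in> measurable (restrict_space (shift_borel A) X) (restrict_space (shift_borel A) Y) \<and>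
        inv_into X \<Phi>
          \<in> measurable (restrict_space (shift_borel A) Y) (restrict_space (shift_borel A) X) \<and>
        (\<forall>\<omega>\<in>X. \<Phi> (shift_map \<omega>) = shift_map (\<Phi> \<omega>)) \<and>
        (\<forall>B\<in>sets (shift_borel A). B \<subseteq> X \<longrightarrow>
          emeasure (markov_measure p) B = emeasure (markov_measure p') (\<Phi> ` B))"
    unfolding shift_isomorphic_def by (elim exE) (rule that)
  have X: "X \<in> sets (shift_borel A)" "emeasure (markov_measure p) X = 1"
    and Y: "Y \<in> sets (shift_borel A)" "emeasure (markov_measure p') Y = 1"
    and \<Phi>: "bij_betw \<Phi> X Y" "shift_map ` X \<subseteq> X" "\<And>\<omega>. \<omega> \<in> X \<Longrightarrow> \<Phi> (shift_map \<omega>) = shift_map (\<Phi> \<omega>)"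
    and meas: "\<And>B. B \<in> sets (shift_borel A) \<Longrightarrow> B \<subseteq> X \<Longrightarrow>
        emeasure (markov_measure p) B = emeasure (markov_measure p') (\<Phi> ` B)"
    using H by simp_all
  have "emeasure (markov_measure p) (branch_points X) = emeasure (markov_measure p') (branch_points Y)"
    using meas[OF emeasure_branch_points(1)[OF p X]] branch_points_image[OF \<Phi>]
    by (simp add: branch_points_def)
  then have "1 / (2 - p) = 1 / (2 - p')"
    using p p' by (simp add: emeasure_branch_points(2)[OF p X] emeasure_branch_points(2)[OF p' Y])
  then show "p = p'"
    using p p' by (simp add: field_simps)
qed (simp add: shift_isomorphic_refl prob_space_markov_measure)

end

section \<open>Entropy spectra\<close>

text \<open>Countable subadditivity for sums over an unordered countable set, the form in which
  covers occur in \<open>bowen_entropy\<close>.\<close>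

lemma emeasure_countable_UN_le_infsum:
  assumes K: "countable K" and D: "\<And>x. x \<in> K \<Longrightarrow> D x \<in> sets M"
    and le: "\<And>x. x \<in> K \<Longrightarrow> emeasure M (D x) \<le> f x"
  shows "emeasure M (\<Union>x\<in>K. D x) \<le> infsum f K"
proof -
  define F where "F n = {x \<in> K. to_nat_on K x < n}" for n
  have fin: "finite (F n)" for n
  proof (rule inj_on_finite[of "to_nat_on K" _ "{..<n}"])
    show "inj_on (to_nat_on K) (F n)"
      using inj_on_to_nat_on[OF K] by (rule inj_on_subset) (auto simp: F_def)
  qed (auto simp: F_def)
  have UN: "(\<Union>x\<in>K. D x) = (\<Union>n. \<Union>x\<in>F n. D x)"
    by (auto simp: F_def)
  have "emeasure M (\<Union>n. \<Union>x\<in>F n. D x) = (SUP n. emeasure M (\<Union>x\<in>F n. D x))"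
  proof (rule SUP_emeasure_incseq[symmetric])
    show "range (\<lambda>n. \<Union>x\<in>F n. D x) \<subseteq> sets M"
      using fin D by (auto simp: F_def intro!: sets.finite_UN)
    show "incseq (\<lambda>n. \<Union>x\<in>F n. D x)"
      by (rule incseq_SucI) (auto simp: F_def)
  qed
  also have "\<dots> \<le> infsum f K"
  proof (rule SUP_least)
    fix n
    have "emeasure M (\<Union>x\<in>F n. D x) \<le> (\<Sum>x\<in>F n. emeasure M (D x))"
      by (rule emeasure_subadditive_finite[OF fin]) (use D in \<open>auto simp: F_def\<close>)
    also have "\<dots> \<le> sum f (F n)"
      by (rule sum_mono) (use le in \<open>auto simp: F_def\<close>)
    also have "\<dots> = infsum f (F n)" by (simp add: fin)
    also have "\<dots> \<le> infsum f K"
      by (rule infsum_mono_neutral) (auto simp: F_def nonneg_summable_on_complete)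
    finally show "emeasure M (\<Union>x\<in>F n. D x) \<le> infsum f K" .
  qed
  finally show ?thesis unfolding UN .
qed

text \<open>The empty cover is available at every length, so every \<open>s\<close> \<ge> 0 is
  admissible. Consequently a nonzero value of the spectrum forces a nonempty level set.\<close>

lemma bowen_entropy_empty: "bowen_entropy A {} = 0"
proof -
  have "(INF K\<in>cylinder_covers A n {}. \<Sum>\<^sub>\<infinity>(m, \<omega>)\<in>K. ennreal (exp (- s * real m))) = 0" for n s
  proof -
    have "{} \<in> cylinder_covers A n {}" by (simp add: cylinder_covers_def)
    then have "(INF K\<in>cylinder_covers A n {}. \<Sum>\<^sub>\<infinity>(m, \<omega>)\<in>K. ennreal (exp (- s * real m))) \<le> 0"
      by (rule INF_lower2) simp
    then show ?thesis by simp
  qed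
  then have "bowen_entropy A {} = Inf {0..}"
    unfolding bowen_entropy_def by (simp add: atLeast_def)
  then show ?thesis by simp
qed

text \<open>All complete blocks have the same sum, so the deviation from linear growth comes from
  the last incomplete block and stays bounded.\<close>

lemma tendsto_average_blocks:
  fixes g :: "nat \<Rightarrow> real"
  assumes L: "0 < L" and block: "\<And>q. (\<Sum>r<L. g (q * L + r)) = T" and bound: "\<And>k. \<bar>g k\<bar> \<le> B"
  shows "(\<lambda>n. (\<Sum>k<n. g k) / real n) \<longlonglongrightarrow> T / real L"
proof -
  have mult: "(\<Sum>k<q * L. g k) = real q * T" for q
  proof (induction q)
    case (Suc q)
    have "(\<Sum>k<Suc q * L. g k) = (\<Sum>k<q * L. g k) + (\<Sum>r<L. g (q * L + r))"
      using sum.atLeastLessThan_concat[of 0 "q * L" "q * L + L" g] sum.shift_bounds_nat_ivl[of g 0 "q * L" L]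
      by (simp add: lessThan_atLeast0 add.commute)
    then show ?case using Suc block[of q] by (simp add: algebra_simps)
  qed simp
  have dev: "\<bar>(\<Sum>k<n. g k) - real n * (T / real L)\<bar> \<le> \<bar>T\<bar> + real L * B" for n
  proof -
    define q r where "q = n div L" and "r = n mod L"
    have n: "n = q * L + r" and r: "r < L" using L by (auto simp: q_def r_def)
    have "(\<Sum>k<n. g k) = (\<Sum>k<q * L. g k) + (\<Sum>k\<in>{q * L..<n}. g k)"
      using sum.atLeastLessThan_concat[of 0 "q * L" n g] n by (simp add: lessThan_atLeast0)
    moreover have "\<bar>\<Sum>k\<in>{q * L..<n}. g k\<bar> \<le> real L * B"
    proof -
      have "\<bar>\<Sum>k\<in>{q * L..<n}. g k\<bar> \<le> (\<Sum>k\<in>{q * L..<n}. \<bar>g k\<bar>)" by (rule sum_abs)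
      also have "\<dots> \<le> (\<Sum>k\<in>{q * L..<n}. B)" by (rule sum_mono) (rule bound)
      also have "\<dots> = real r * B" using n by simp
      also have "\<dots> \<le> real L * B"
        using r bound[of 0] by (intro mult_right_mono) auto
      finally show ?thesis .
    qed
    moreover have "\<bar>real q * T - real n * (T / real L)\<bar> \<le> \<bar>T\<bar>"
    proof -
      have "real q * T - real n * (T / real L) = - (real r / real L) * T"
        using L by (simp add: n field_simps)
      moreover have "\<bar>- (real r / real L) * T\<bar> \<le> 1 * \<bar>T\<bar>"
        unfolding abs_mult using r by (intro mult_right_mono) auto
      ultimately show ?thesis by simp
    qed
    ultimately show ?thesis unfolding mult by linarith
  qed
  have "(\<lambda>n. (\<Sum>k<n. g k) / real n - T / real L) \<longlonglongrightarrow> 0"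
  proof (rule Lim_null_comparison)
    show "\<forall>\<^sub>F n in sequentially. norm ((\<Sum>k<n. g k) / real n - T / real L) \<le> (\<bar>T\<bar> + real L * B) / real n"
      using eventually_gt_at_top[of 0]
    proof eventually_elim
      case (elim n)
      then have "(\<Sum>k<n. g k) / real n - T / real L = ((\<Sum>k<n. g k) - real n * (T / real L)) / real n"
        by (simp add: field_simps)
      then show ?case
        using dev[of n] elim by (simp add: abs_divide divide_right_mono)
    qed
    show "(\<lambda>n. (\<bar>T\<bar> + real L * B) / real n) \<longlonglongrightarrow> 0"
      by (rule lim_const_over_n)
  qed
  then show ?thesis by (simp add: LIM_zero_iff)
qed

fun path_sum :: "('a \<Rightarrow> 'a \<Rightarrow> real) \<Rightarrow> 'a list \<Rightarrow> real" where
  "path_sum g (s # t # u) = g s t + path_sum g (t # u)"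
| "path_sum g u = 0"

lemma path_sum_conv_sum: "path_sum g u = (\<Sum>k<length u - 1. g (u ! k) (u ! Suc k))"
proof (induction g u rule: path_sum.induct)
  case (1 g s t u)
  then show ?case by (simp add: sum.lessThan_Suc_shift del: sum.lessThan_Suc)
qed auto

text \<open>The two pieces share the letter \<open>s\<close>, so each transition is counted
  once.\<close>

lemma path_sum_append: "path_sum g (u @ s # v) = path_sum g (u @ [s]) + path_sum g (s # v)"
proof (induction u rule: induct_list012)
  case (3 x y zs)
  then show ?case by simp
qed auto

section \<open>Lower bounds for Bowen entropy\<close>

context golden_mean_shift
begin

text \<open>Lower bounds for \<open>Inf\<close> on the reals require a nonempty set. The value 2
  belongs to it: there are at most 2^n words of length n, and 2 * exp (- 2) < 1.\<close>

lemma bowen_entropy_admissible: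
  assumes Z: "Z \<subseteq> markov_shift A"
  shows "(\<lambda>n. INF K\<in>cylinder_covers A n Z. \<Sum>\<^sub>\<infinity>(m, \<omega>)\<in>K. ennreal (exp (- 2 * real m))) \<longlonglongrightarrow> 0"
proof (rule tendsto_sandwich[of "\<lambda>_. 0"])
  let ?h = "\<lambda>n. INF K\<in>cylinder_covers A n Z. \<Sum>\<^sub>\<infinity>(m, \<omega>)\<in>K. ennreal (exp (- 2 * real m))"
  have "?h n \<le> ennreal ((2 / 3) ^ n)" for n
  proof -
    define W where "W = {u \<in> words n. word_cylinder A u \<noteq> {}}"
    \<comment> \<open>Covers are described by points, so each nonempty word cylinder needs a
      representative.\<close>
    define rep where "rep u = (SOME \<omega>. \<omega> \<in> word_cylinder A u)" for u
    define K where "K = (\<lambda>u. (n, rep u)) ` W"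
    have rep: "rep u \<in> word_cylinder A u" if "u \<in> W" for u
      using that some_in_eq[of "word_cylinder A u"] by (simp add: rep_def W_def)
    have fin: "finite W" by (simp add: W_def)
    then have finK: "finite K" by (simp add: K_def)
    have cov: "K \<in> cylinder_covers A n Z"
      unfolding cylinder_covers_def
    proof (intro CollectI conjI subsetI)
      show "countable K" using finK by (rule countable_finite)
      show "x \<in> {n..} \<times> markov_shift A" if "x \<in> K" for x
        using that rep by (auto simp: K_def word_cylinder_def)
      fix \<omega> assume "\<omega> \<in> Z"
      then have \<omega>: "\<omega> \<in> markov_shift A" using Z by blast
      let ?u = "map \<omega> [0..<n]"
      have mem: "\<omega> \<in> word_cylinder A ?u" using \<omega> by (simp add: word_cylinder_def)
      then have u: "?u \<in> W" using prefix_in_words[OF \<omega>] by (auto simp: W_def)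
      have "\<omega> \<in> cylinder A n (rep ?u)"
        using mem word_cylinder_eq_cylinder[OF rep[OF u]] by simp
      then show "\<omega> \<in> (\<Union>(m, \<omega>)\<in>K. cylinder A m \<omega>)"
        using u by (auto simp: K_def)
    qed
    have "?h n \<le> (\<Sum>\<^sub>\<infinity>(m, \<omega>)\<in>K. ennreal (exp (- 2 * real m)))"
      using cov by (rule INF_lower)
    also have "\<dots> = (\<Sum>x\<in>K. ennreal (exp (- 2 * real n)))"
    proof -
      have "(case x of (m, \<omega>) \<Rightarrow> ennreal (exp (- 2 * real m))) = ennreal (exp (- 2 * real n))" if "x \<in> K" for x
        using that unfolding K_def by fastforce
      then show ?thesis unfolding infsum_finite[OF finK] by (rule sum.cong[OF refl])
    qed
    also have "\<dots> \<le> ennreal (2 ^ n * exp (- 2 * real n))"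
    proof -
      have "card K \<le> card W" unfolding K_def by (rule card_image_le[OF fin])
      also have "\<dots> \<le> card (words n)" by (rule card_mono) (auto simp: W_def)
      finally have "real (card K) \<le> real (2 ^ n)" unfolding card_words by (rule of_nat_mono)
      then have "real (card K) * exp (- 2 * real n) \<le> 2 ^ n * exp (- 2 * real n)"
        by (intro mult_right_mono) simp_all
      moreover have "(\<Sum>x\<in>K. ennreal (exp (- 2 * real n))) = ennreal (\<Sum>x\<in>K. exp (- 2 * real n))"
        by (rule sum_ennreal) simp
      ultimately show ?thesis by (simp only: sum_constant ennreal_leI)
    qed
    also have "2 ^ n * exp (- 2 * real n) = (2 * exp (- 2)) ^ n"
      unfolding power_mult_distrib exp_of_nat_mult[symmetric] by (simp only: mult.commute)
    also have "\<dots> \<le> (2 / 3) ^ n"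
    proof (rule power_mono)
      have "3 \<le> exp (2::real)" using exp_ge_add_one_self[of 2] by simp
      then show "2 * exp (- 2) \<le> (2 / 3 :: real)" by (simp add: exp_minus field_simps)
    qed simp
    finally show ?thesis by (simp add: ennreal_leI)
  qed
  then show "\<forall>\<^sub>F n in sequentially. ?h n \<le> ennreal ((2 / 3) ^ n)" by simp
  have "(\<lambda>n. (2 / 3 :: real) ^ n) \<longlonglongrightarrow> 0" by (rule LIMSEQ_realpow_zero) auto
  then have "(\<lambda>n. ennreal ((2 / 3) ^ n)) \<longlonglongrightarrow> ennreal 0" by (rule tendsto_ennrealI)
  then show "(\<lambda>n. ennreal ((2 / 3) ^ n)) \<longlonglongrightarrow> 0" by simp
qed auto

text \<open>Mass distribution principle for the image of the fair coin flips under an injective coding.\<close>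

lemma bowen_entropy_pos:
  fixes code :: "(nat \<Rightarrow> bool) \<Rightarrow> nat \<Rightarrow> nat"
  assumes L: "0 < L" and Z: "Z \<subseteq> markov_shift A" and code: "\<And>b. code b \<in> Z"
    and decode: "\<And>b n. b n \<longleftrightarrow> code b (n * L + (L - 1)) = s0"
  shows "0 < bowen_entropy A Z"
proof -
  \<comment> \<open>A cylinder of length m contains m div L complete blocks, which gives mass 2^(-(m
    div L)). The factor 2 absorbs the rounding, as m \<le> 2 * L * (m div L) for m \<ge> L.\<close>
  define s\<^sub>0 where "s\<^sub>0 = ln 2 / (2 * real L)"
  have s0: "0 < s\<^sub>0" using L by (simp add: s\<^sub>0_def)
  have "s\<^sub>0 \<le> s" if s: "0 \<le> s"
    and lim: "(\<lambda>n. INF K\<in>cylinder_covers A n Z. \<Sum>\<^sub>\<infinity>(m, \<omega>)\<in>K. ennreal (exp (- s * real m))) \<longlonglongrightarrow> 0" for s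
  proof (rule ccontr)
    assume "\<not> s\<^sub>0 \<le> s"
    let ?M = "coin_flips (\<lambda>_. 1 / 2)"
    interpret prob_space ?M by (rule prob_space_coin_flips)
    have "1 \<le> (INF K\<in>cylinder_covers A n Z. \<Sum>\<^sub>\<infinity>(m, \<omega>)\<in>K. ennreal (exp (- s * real m)))" if n: "L \<le> n" for n
    proof (rule INF_greatest)
      fix K assume "K \<in> cylinder_covers A n Z"
      then have K: "countable K" "K \<subseteq> {n..} \<times> markov_shift A" "Z \<subseteq> (\<Union>(m, \<omega>)\<in>K. cylinder A m \<omega>)"
        by (auto simp: cylinder_covers_def)
      \<comment> \<open>The flips that are compatible with the complete blocks of the cylinder. This
        event contains the preimage of the cylinder under \<open>code\<close>, and it constrains
        finitely many flips, whence its measurability and mass.\<close>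
      define D where "D = (\<lambda>(m, \<omega>). {b. \<forall>q<m div L. b q \<in> {(\<omega> :: nat \<Rightarrow> nat) (q * L + (L - 1)) = s0}})"
      have "UNIV \<subseteq> (\<Union>x\<in>K. D x)"
      proof
        fix b :: "nat \<Rightarrow> bool"
        obtain m \<omega> where m: "(m, \<omega>) \<in> K" "code b \<in> cylinder A m \<omega>"
          using K(3) code[of b] by blast
        have "b q = (\<omega> (q * L + (L - 1)) = s0)" if "q < m div L" for q
        proof -
          have "Suc q * L \<le> m"
            using that by (metis Suc_leI div_times_less_eq_dividend le_trans mult_le_mono1)
          then have "q * L + (L - 1) < m" using L by simp
          then show ?thesis using m(2) decode[of b q] by (simp add: cylinder_def)
        qed
        then have "b \<in> D (m, \<omega>)" by (simp add: D_def)
        then show "b \<in> (\<Union>x\<in>K. D x)" using m(1) by blast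
      qed
      then have "1 = emeasure ?M (\<Union>x\<in>K. D x)"
        using emeasure_space_1 by (simp add: top.extremum_unique)
      also have "\<dots> \<le> infsum (\<lambda>(m, \<omega>). ennreal (exp (- s * real m))) K"
      proof (rule emeasure_countable_UN_le_infsum[OF K(1)])
        fix x assume "x \<in> K"
        then obtain m \<omega> where x: "x = (m, \<omega>)" "n \<le> m" using K(2) by auto
        show "D x \<in> sets ?M"
        proof -
          have "D x = {b \<in> space ?M. \<forall>q\<in>{..<m div L}. b q = (\<omega> (q * L + (L - 1)) = s0)}"
            by (auto simp: D_def x)
          also have "\<dots> \<in> sets ?M" by measurable
          finally show ?thesis .
        qed
        have "measure ?M (D x) = (1 / 2) ^ (m div L)"
        proof -
          have "pmf (bernoulli_pmf (1 / 2)) c = 1 / 2" for c by (cases c) auto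
          moreover have "D x = {b. \<forall>q<m div L. b q \<in> {\<omega> (q * L + (L - 1)) = s0}}"
            by (simp add: D_def x)
          ultimately show ?thesis
            unfolding measure_coin_flips by (simp only: measure_coin_flips measure_pmf_single prod_constant card_lessThan)
        qed
        also have "\<dots> = exp (- ln 2 * real (m div L))"
          by (simp add: exp_minus power_one_over mult.commute[of "ln 2"] exp_of_nat_mult inverse_eq_divide)
        also have "\<dots> \<le> exp (- s * real m)"
        proof -
          have "1 \<le> m div L" using x(2) n L by (simp add: div_greater_zero_iff Suc_le_eq)
          moreover have "m = (m div L) * L + m mod L" by simp
          moreover have "m mod L < L" using L by simp
          ultimately have "m \<le> 2 * L * (m div L)"
            by (metis add_mono_thms_linordered_semiring(2) div_mult_mod_eq less_imp_le_nat mult.commute mult.left_commute mult_2 mult_le_mono2 nat_mult_1_right order_trans)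
          then have "real m \<le> 2 * real L * real (m div L)"
            by (metis of_nat_le_iff of_nat_mult of_nat_numeral)
          then have "s\<^sub>0 * real m \<le> s\<^sub>0 * (2 * real L * real (m div L))"
            using s0 by (intro mult_left_mono) auto
          also have "\<dots> = ln 2 * real (m div L)" using L by (simp add: s\<^sub>0_def)
          finally have "s * real m \<le> ln 2 * real (m div L)"
            using \<open>\<not> s\<^sub>0 \<le> s\<close> mult_right_mono[of s s\<^sub>0 "real m"] by simp
          then show ?thesis by simp
        qed
        finally show "emeasure ?M (D x) \<le> (case x of (m, \<omega>) \<Rightarrow> ennreal (exp (- s * real m)))"
          by (simp add: x emeasure_eq_measure ennreal_leI)
      qed
      finally show "1 \<le> (\<Sum>\<^sub>\<infinity>(m, \<omega>)\<in>K. ennreal (exp (- s * real m)))" .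
    qed
    then have "1 \<le> (0 :: ennreal)"
      using lim by (intro LIMSEQ_le_const) auto
    then show False by simp
  qed
  then have "s\<^sub>0 \<le> bowen_entropy A Z"
    unfolding bowen_entropy_def using bowen_entropy_admissible[OF Z]
    by (intro cInf_greatest) (auto intro: exI[of _ 2])
  then show ?thesis using s0 by simp
qed

text \<open>
  The logarithm of the transition probabilities up to a coboundary, made symmetric in the two
  transitions through \<open>j\<close>.
\<close>

definition log_step :: "real \<Rightarrow> nat \<Rightarrow> nat \<Rightarrow> real" where
  "log_step p s t = (if s = i \<and> t = i then ln p else ln (1 - p) / 2)"

lemma log_weight_bound:
  assumes p: "0 < p" "p < 1"
  obtains B where "\<And>\<omega> n. \<omega> \<in> markov_shift A \<Longrightarrow>
    \<bar>ln (measure (markov_measure p) (cylinder A n \<omega>)) - (\<Sum>k<n. log_step p (\<omega> k) (\<omega> (Suc k)))\<bar> \<le> B"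
proof
  \<comment> \<open>The transfer function of the coboundary by which \<open>log_step\<close> differs
    from the true logarithm.\<close>
  define v where "v s = (if s = i then 0 else - ln (1 - p) / 2)" for s
  \<comment> \<open>The bound collects the initial law, the two ends of the telescoping sum, and the
    one transition by which n summands exceed a cylinder of length n.\<close>
  let ?B = "(\<bar>ln (stationary p i)\<bar> + \<bar>ln (stationary p j)\<bar>) + 2 * \<bar>v j\<bar> + (\<bar>ln p\<bar> + \<bar>ln (1 - p) / 2\<bar>)"
  have bound: "\<bar>a + b - c - d\<bar> \<le> K + 2 * V + M" if "\<bar>a\<bar> \<le> K" "\<bar>b\<bar> \<le> V" "\<bar>c\<bar> \<le> V" "\<bar>d\<bar> \<le> M"
    for a b c d K V M :: real
    using that by linarith
  fix \<omega> n assume \<omega>: "\<omega> \<in> markov_shift A"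
  have mem: "\<omega> k \<in> {i, j}" for k using \<omega> by (auto simp: markov_shift_eq)
  show "\<bar>ln (measure (markov_measure p) (cylinder A n \<omega>)) - (\<Sum>k<n. log_step p (\<omega> k) (\<omega> (Suc k)))\<bar> \<le> ?B"
  proof (cases n)
    case 0
    interpret prob_space "markov_measure p" by (rule prob_space_markov_measure)
    have "cylinder A 0 \<omega> = space (markov_measure p)" by (simp add: cylinder_def)
    then show ?thesis using prob_space by (simp only: 0) simp
  next
    case (Suc m)
    have pos: "0 < step p (\<omega> k) (\<omega> (Suc k))" for k
      using transition_cases[OF \<omega>, of k] by cases (use p in \<open>auto simp: step_def\<close>)
    have ln_step: "ln (step p (\<omega> k) (\<omega> (Suc k))) = log_step p (\<omega> k) (\<omega> (Suc k)) + v (\<omega> k) - v (\<omega> (Suc k))" for k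
      using transition_cases[OF \<omega>, of k] by cases (use neq in \<open>auto simp: step_def log_step_def v_def\<close>)
    have nz: "step p (\<omega> k) (\<omega> (Suc k)) \<noteq> 0" for k using pos[of k] by simp
    have "0 < stationary p (\<omega> 0)" using p by (simp add: stationary_def)
    have "measure (markov_measure p) (cylinder A n \<omega>) = weight p (map \<omega> [0..<n])"
      unfolding cylinder_eq_word_cylinder by (rule measure_markov_measure[OF p]) (use mem in auto)
    also have "\<dots> = stationary p (\<omega> 0) * (\<Prod>k<m. step p (\<omega> k) (\<omega> (Suc k)))"
      unfolding Suc by (rule weight_prefix)
    also have "ln \<dots> = ln (stationary p (\<omega> 0)) + ln (\<Prod>k<m. step p (\<omega> k) (\<omega> (Suc k)))"
      by (rule ln_mult_pos[OF \<open>0 < stationary p (\<omega> 0)\<close>]) (rule prod_pos, rule pos)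
    also have "ln (\<Prod>k<m. step p (\<omega> k) (\<omega> (Suc k))) = (\<Sum>k<m. ln (step p (\<omega> k) (\<omega> (Suc k))))"
      by (rule ln_prod[OF finite_lessThan nz])
    also have "(\<Sum>k<m. ln (step p (\<omega> k) (\<omega> (Suc k)))) = (\<Sum>k<m. log_step p (\<omega> k) (\<omega> (Suc k))) + v (\<omega> 0) - v (\<omega> m)"
      unfolding ln_step by (induction m) auto
    finally have eq: "ln (measure (markov_measure p) (cylinder A n \<omega>)) - (\<Sum>k<n. log_step p (\<omega> k) (\<omega> (Suc k))) =
        ln (stationary p (\<omega> 0)) + v (\<omega> 0) - v (\<omega> m) - log_step p (\<omega> m) (\<omega> n)"
      unfolding Suc by simp
    have v_le: "\<bar>v s\<bar> \<le> \<bar>v j\<bar>" if "s \<in> {i, j}" for s using that by (auto simp: v_def)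
    show ?thesis
      unfolding eq
    proof (rule bound)
      show "\<bar>ln (stationary p (\<omega> 0))\<bar> \<le> \<bar>ln (stationary p i)\<bar> + \<bar>ln (stationary p j)\<bar>"
        using mem[of 0] by auto
      show "\<bar>log_step p (\<omega> m) (\<omega> n)\<bar> \<le> \<bar>ln p\<bar> + \<bar>ln (1 - p) / 2\<bar>"
        by (auto simp: log_step_def)
    qed (rule v_le[OF mem])+
  qed
qed

lemma local_entropy_level_markov:
  assumes p: "0 < p" "p < 1"
  shows "local_entropy_level A (markov_measure p) \<alpha> =
    {\<omega> \<in> markov_shift A. (\<lambda>n. (\<Sum>k<n. log_step p (\<omega> k) (\<omega> (Suc k))) / real n) \<longlonglongrightarrow> - \<alpha>}"
proof -
  obtain B where B: "\<And>\<omega> n. \<omega> \<in> markov_shift A \<Longrightarrow>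
    \<bar>ln (measure (markov_measure p) (cylinder A n \<omega>)) - (\<Sum>k<n. log_step p (\<omega> k) (\<omega> (Suc k)))\<bar> \<le> B"
    using log_weight_bound[OF p] by blast
  have "((\<lambda>n. - (1 / real n) * ln (measure (markov_measure p) (cylinder A n \<omega>))) \<longlonglongrightarrow> \<alpha>) \<longleftrightarrow>
      (\<lambda>n. (\<Sum>k<n. log_step p (\<omega> k) (\<omega> (Suc k))) / real n) \<longlonglongrightarrow> - \<alpha>"
    (is "(?a \<longlonglongrightarrow> \<alpha>) \<longleftrightarrow> (?b \<longlonglongrightarrow> - \<alpha>)") if \<omega>: "\<omega> \<in> markov_shift A" for \<omega>
  proof -
    have diff: "(\<lambda>n. ?a n + ?b n) \<longlonglongrightarrow> 0"
    proof (rule Lim_null_comparison)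
      show "\<forall>\<^sub>F n in sequentially. norm (?a n + ?b n) \<le> B / real n"
      proof (rule always_eventually, rule allI)
        fix n
        have "?a n + ?b n = - ((ln (measure (markov_measure p) (cylinder A n \<omega>)) -
            (\<Sum>k<n. log_step p (\<omega> k) (\<omega> (Suc k)))) / real n)"
          by (simp add: diff_divide_distrib)
        then show "norm (?a n + ?b n) \<le> B / real n"
          using B[OF \<omega>, of n] by (simp add: abs_divide divide_right_mono del: times_divide_eq_left)
      qed
      show "(\<lambda>n. B / real n) \<longlonglongrightarrow> 0" by (rule lim_const_over_n)
    qed
    show ?thesis
    proof
      assume "?a \<longlonglongrightarrow> \<alpha>"
      from tendsto_diff[OF diff this] show "?b \<longlonglongrightarrow> - \<alpha>" by simp
    next
      assume "?b \<longlonglongrightarrow> - \<alpha>"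
      from tendsto_diff[OF diff this] show "?a \<longlonglongrightarrow> \<alpha>" by simp
    qed
  qed
  then show ?thesis unfolding local_entropy_level_def by blast
qed

text \<open>Averages of the two values of \<open>log_step\<close> stay between them, so all other
  level sets are empty.\<close>

lemma entropy_spectrum_support:
  assumes p: "0 < p" "p < 1" and ne: "entropy_spectrum A (markov_measure p) \<alpha> \<noteq> 0"
  shows "min (ln p) (ln (1 - p) / 2) \<le> - \<alpha>" "- \<alpha> \<le> max (ln p) (ln (1 - p) / 2)"
proof -
  have "local_entropy_level A (markov_measure p) \<alpha> \<noteq> {}"
    using ne bowen_entropy_empty by (auto simp: entropy_spectrum_def)
  then obtain \<omega> where lim: "(\<lambda>n. (\<Sum>k<n. log_step p (\<omega> k) (\<omega> (Suc k))) / real n) \<longlonglongrightarrow> - \<alpha>"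
    by (auto simp: local_entropy_level_markov[OF p])
  let ?lo = "min (ln p) (ln (1 - p) / 2)" and ?hi = "max (ln p) (ln (1 - p) / 2)"
  have "?lo \<le> log_step p s t" "log_step p s t \<le> ?hi" for s t
    by (auto simp: log_step_def)
  then have "real n * ?lo \<le> (\<Sum>k<n. log_step p (\<omega> k) (\<omega> (Suc k)))"
    "(\<Sum>k<n. log_step p (\<omega> k) (\<omega> (Suc k))) \<le> real n * ?hi" for n
    using sum_bounded_below[of "{..<n}" ?lo "\<lambda>k. log_step p (\<omega> k) (\<omega> (Suc k))"]
      sum_bounded_above[of "{..<n}" "\<lambda>k. log_step p (\<omega> k) (\<omega> (Suc k))" ?hi]
    by simp_all
  then have le: "?lo \<le> (\<Sum>k<n. log_step p (\<omega> k) (\<omega> (Suc k))) / real n"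
    "(\<Sum>k<n. log_step p (\<omega> k) (\<omega> (Suc k))) / real n \<le> ?hi" if "1 \<le> n" for n
    using that by (simp_all add: pos_le_divide_eq pos_divide_le_eq mult.commute)
  show "?lo \<le> - \<alpha>" using LIMSEQ_le_const[OF lim] le by blast
  show "- \<alpha> \<le> ?hi" using LIMSEQ_le_const2[OF lim] le by blast
qed

text \<open>
  Free concatenations of the two blocks \<open>w @ [i]\<close> and \<open>i # w\<close> have the same Birkhoff averages,
  since both blocks, followed by \<open>i\<close>, contain the same transitions.
\<close>

lemma entropy_spectrum_pos:
  assumes p: "0 < p" "p < 1" and w: "w \<noteq> []" "hd w = i" "last w = j" "set w \<subseteq> {i, j}"
    and valid: "successively (\<lambda>s t. s = j \<longrightarrow> t = i) w"
  shows "0 < entropy_spectrum A (markov_measure p)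
    (- ((path_sum (log_step p) w + ln (1 - p) / 2 + ln p) / real (Suc (length w))))"
proof -
  let ?\<alpha> = "- ((path_sum (log_step p) w + ln (1 - p) / 2 + ln p) / real (Suc (length w)))"
  define L where "L = Suc (length w)"
  \<comment> \<open>The two blocks differ in their last letter, \<open>i\<close> or
    \<open>j\<close>, from which the flip can be read off.\<close>
  define blk where "blk c = (if c then w @ [i] else i # w)" for c :: bool
  define code where "code b n = blk (b (n div L)) ! (n mod L)" for b n
  have L: "0 < L" by (simp add: L_def)
  have len: "length (blk c) = L" for c by (simp add: blk_def L_def)
  have hd_w: "w = i # tl w" using w(1,2) by (cases w) auto
  have last_w: "w = butlast w @ [j]" using append_butlast_last_id[OF w(1)] w(3) by simp
  have blk_0: "blk c ! 0 = i" for c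
    using w(1,2) by (simp add: blk_def nth_append hd_conv_nth)
  \<comment> \<open>Every block starts with \<open>i\<close>, so the appended \<open>i\<close>
    accounts for the transition into the next block.\<close>
  have blk_valid: "successively (\<lambda>s t. s = j \<longrightarrow> t = i) (blk c @ [i])" for c
    using valid w(1,2,3) neq by (auto simp: blk_def successively_append_iff successively_Cons)
  \<comment> \<open>The case \<open>r = L\<close> is included on purpose: it is the first letter of
    the next block.\<close>
  have code_block: "code b (q * L + r) = (blk (b q) @ [i]) ! r" if "r \<le> L" for b q r
  proof (cases "r = L")
    case True
    then have "code b (q * L + r) = code b (Suc q * L)" by (simp add: add.commute)
    also have "\<dots> = i" unfolding code_def using L blk_0 by simp
    finally show ?thesis using True len[of "b q"] by (simp add: nth_append)
  next
    case False
    then have "r < L" using that by simp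
    then show ?thesis using L len[of "b q"] by (simp add: code_def nth_append)
  qed
  have split: "n = (n div L) * L + n mod L" for n by simp
  have code_Suc: "code b n = (blk (b (n div L)) @ [i]) ! (n mod L)"
    "code b (Suc n) = (blk (b (n div L)) @ [i]) ! Suc (n mod L)" for b n
  proof -
    have "n mod L < L" using L by simp
    then show "code b n = (blk (b (n div L)) @ [i]) ! (n mod L)"
      "code b (Suc n) = (blk (b (n div L)) @ [i]) ! Suc (n mod L)"
      using code_block[of "n mod L" b "n div L"] code_block[of "Suc (n mod L)" b "n div L"] split[of n]
      by (simp_all add: Suc_le_eq)
  qed
  have shift: "code b \<in> markov_shift A" for b
    unfolding markov_shift_eq
  proof (intro CollectI allI conjI impI)
    fix n
    have "n mod L < length (blk (b (n div L)))" using L len by simp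
    then have "code b n \<in> set (blk (b (n div L)))"
      unfolding code_def by (rule nth_mem)
    also have "\<dots> \<subseteq> {i, j}" using w(4) by (simp add: blk_def)
    finally show "code b n \<in> {i, j}" .
    assume "code b n = j"
    then show "code b (Suc n) = i"
      using blk_valid[of "b (n div L)"] \<open>n mod L < length (blk (b (n div L)))\<close> code_Suc(1)[of b n]
      unfolding code_Suc(2) successively_conv_nth by simp
  qed
  have T: "path_sum (log_step p) (blk c @ [i]) = path_sum (log_step p) w + ln (1 - p) / 2 + ln p" for c
  proof (cases c)
    case True
    have "path_sum (log_step p) (w @ [i, i]) = path_sum (log_step p) w + path_sum (log_step p) [j, i, i]"
      using path_sum_append[of "log_step p" "butlast w" j "[i, i]"] last_w by (metis append.assoc append_Cons append_Nil)
    then show ?thesis using True neq by (simp add: blk_def log_step_def)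
  next
    case False
    have "path_sum (log_step p) (i # w @ [i]) = log_step p i i + path_sum (log_step p) (w @ [i])"
      using hd_w by (metis append_Cons path_sum.simps(1))
    moreover have "path_sum (log_step p) (w @ [i]) = path_sum (log_step p) w + path_sum (log_step p) [j, i]"
      using path_sum_append[of "log_step p" "butlast w" j "[i]"] last_w by (metis append.assoc append_Cons append_Nil)
    ultimately show ?thesis using False neq by (simp add: blk_def log_step_def)
  qed
  have level: "code b \<in> local_entropy_level A (markov_measure p) ?\<alpha>" for b
  proof -
    have "(\<lambda>n. (\<Sum>k<n. log_step p (code b k) (code b (Suc k))) / real n) \<longlonglongrightarrow>
        (path_sum (log_step p) w + ln (1 - p) / 2 + ln p) / real L"
    proof (rule tendsto_average_blocks[OF L])
      fix q
      have "(\<Sum>r<L. log_step p (code b (q * L + r)) (code b (Suc (q * L + r)))) =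
          path_sum (log_step p) (blk (b q) @ [i])"
        unfolding path_sum_conv_sum
      proof (rule sum.cong)
        fix r assume "r \<in> {..<length (blk (b q) @ [i]) - 1}"
        then have "r < L" using len[of "b q"] by simp
        then show "log_step p (code b (q * L + r)) (code b (Suc (q * L + r))) =
            log_step p ((blk (b q) @ [i]) ! r) ((blk (b q) @ [i]) ! Suc r)"
          using code_block[of r b q] code_block[of "Suc r" b q] by simp
      qed (use len[of "b q"] in simp)
      then show "(\<Sum>r<L. log_step p (code b (q * L + r)) (code b (Suc (q * L + r)))) =
          path_sum (log_step p) w + ln (1 - p) / 2 + ln p"
        by (simp add: T)
      show "\<bar>log_step p (code b k) (code b (Suc k))\<bar> \<le> \<bar>ln p\<bar> + \<bar>ln (1 - p) / 2\<bar>" for k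
        by (auto simp: log_step_def)
    qed
    then show ?thesis
      using shift by (simp add: local_entropy_level_markov[OF p] L_def)
  qed
  have "0 < bowen_entropy A (local_entropy_level A (markov_measure p) ?\<alpha>)"
  proof (rule bowen_entropy_pos[OF L _ level])
    show "local_entropy_level A (markov_measure p) ?\<alpha> \<subseteq> markov_shift A"
      by (auto simp: local_entropy_level_def)
    fix b n
    have "code b (n * L + (L - 1)) = (blk (b n) @ [i]) ! (L - 1)"
      by (rule code_block) simp
    also have "\<dots> = (if b n then i else j)"
      using w(1,3) by (auto simp: blk_def L_def nth_append nth_Cons last_conv_nth split: nat.splits)
    finally show "b n \<longleftrightarrow> code b (n * L + (L - 1)) = i" using neq by simp
  qed
  then show ?thesis by (simp add: entropy_spectrum_def)
qed

text \<open>Values with positive spectrum for \<open>p\<close> lie in the closed interval of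
  \<open>p'\<close>, hence so do their limits. Words that mostly repeat one of the two simple cycles
  give averages converging to the corresponding endpoint.\<close>

lemma entropy_spectrum_endpoints:
  assumes p: "0 < p" "p < 1" and p': "0 < p'" "p' < 1"
    and eq: "entropy_spectrum A (markov_measure p) = entropy_spectrum A (markov_measure p')"
  shows "ln p \<in> {min (ln p') (ln (1 - p') / 2)..max (ln p') (ln (1 - p') / 2)}"
    and "ln (1 - p) / 2 \<in> {min (ln p') (ln (1 - p') / 2)..max (ln p') (ln (1 - p') / 2)}"
proof -
  let ?I = "{min (ln p') (ln (1 - p') / 2)..max (ln p') (ln (1 - p') / 2)}"
  define l where "l = ln (1 - p) / 2"
  have mem: "(path_sum (log_step p) w + l + ln p) / real (Suc (length w)) \<in> ?I"
    if "w \<noteq> []" "hd w = i" "last w = j" "set w \<subseteq> {i, j}" "successively (\<lambda>s t. s = j \<longrightarrow> t = i) w" for w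
  proof -
    let ?\<alpha> = "- ((path_sum (log_step p) w + ln (1 - p) / 2 + ln p) / real (Suc (length w)))"
    have "entropy_spectrum A (markov_measure p') ?\<alpha> \<noteq> 0"
      using entropy_spectrum_pos[OF p that] by (simp only: eq)
    from entropy_spectrum_support[OF p' this] show ?thesis
      by (simp only: l_def minus_minus atLeastAtMost_iff)
  qed
  have "(real (Suc m) * ln p + 2 * l) / real (m + 3) \<in> ?I" for m
  proof -
    \<comment> \<open>With the two added transitions there are m + 1 loops at \<open>i\<close> and
      two transitions through \<open>j\<close>.\<close>
    let ?w = "replicate (Suc m) i @ [j]"
    have "path_sum (log_step p) ?w = real m * ln p + l"
      by (induction m) (use neq in \<open>auto simp: log_step_def l_def algebra_simps\<close>)
    moreover have "successively (\<lambda>s t. s = j \<longrightarrow> t = i) ?w"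
      by (induction m) (use neq in auto)
    moreover have "set (replicate m i) \<subseteq> {i, j}" by auto
    ultimately show ?thesis using mem[of ?w] by (simp add: algebra_simps)
  qed
  moreover have "(\<lambda>m. (real (Suc m) * ln p + 2 * l) / real (m + 3)) \<longlonglongrightarrow> ln p"
    by real_asymp
  ultimately show "ln p \<in> ?I"
    by (intro Lim_in_closed_set[OF closed_atLeastAtMost]) auto
  have "(real (2 * m + 2) * l + ln p) / real (2 * m + 3) \<in> ?I" for m
  proof -
    \<comment> \<open>All transitions pass through \<open>j\<close>, except for the single loop at
      \<open>i\<close> which the blocks add.\<close>
    let ?w = "concat (replicate (Suc m) [i, j])"
    have w: "path_sum (log_step p) ?w = real (2 * m + 1) * l \<and> successively (\<lambda>s t. s = j \<longrightarrow> t = i) ?w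
        \<and> length ?w = 2 * m + 2 \<and> hd ?w = i \<and> last ?w = j"
      by (induction m) (use neq in \<open>auto simp: log_step_def l_def algebra_simps\<close>)
    then show ?thesis using mem[of ?w] by (simp add: algebra_simps)
  qed
  moreover have "(\<lambda>m. (real (2 * m + 2) * l + ln p) / real (2 * m + 3)) \<longlonglongrightarrow> l"
    by real_asymp
  ultimately have "l \<in> ?I"
    by (intro Lim_in_closed_set[OF closed_atLeastAtMost]) auto
  then show "ln (1 - p) / 2 \<in> ?I" by (simp add: l_def)
qed

lemma entropy_spectrum_markov_measure_iff:
  assumes p: "0 < p" "p < 1" and p': "0 < p'" "p' < 1"
  shows "entropy_spectrum A (markov_measure p) = entropy_spectrum A (markov_measure p') \<longleftrightarrow> p = p'"
proof
  assume eq: "entropy_spectrum A (markov_measure p) = entropy_spectrum A (markov_measure p')"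
  \<comment> \<open>Each pair of endpoints lies in the interval spanned by the other pair, so the
    intervals coincide and the endpoints agree either in order or crosswise.\<close>
  have "ln p = ln p' \<or> (ln p = ln (1 - p') / 2 \<and> ln p' = ln (1 - p) / 2)"
    using entropy_spectrum_endpoints[OF p p' eq] entropy_spectrum_endpoints[OF p' p eq[symmetric]]
    by (auto simp: min_def max_def split: if_splits)
  then show "p = p'"
  proof
    assume "ln p = ln p'"
    then show ?thesis using p p' by simp
  next
    assume ln: "ln p = ln (1 - p') / 2 \<and> ln p' = ln (1 - p) / 2"
    have sq: "x\<^sup>2 = 1 - y" if "ln x = ln (1 - y) / 2" "0 < x" "y < 1" for x y :: real
    proof -
      have "ln (x\<^sup>2) = ln (1 - y)" using that by (simp add: ln_realpow)
      then show ?thesis using that by simp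
    qed
    have "p\<^sup>2 = 1 - p'" "p'\<^sup>2 = 1 - p" using ln sq p p' by blast+
    then have "(p - p') * (p + p' - 1) = 0" by (simp add: power2_eq_square algebra_simps)
    moreover have "p + p' \<noteq> 1"
    proof
      assume "p + p' = 1"
      then have "p * p = p" using \<open>p\<^sup>2 = 1 - p'\<close> by (simp add: power2_eq_square)
      then show False using p by simp
    qed
    ultimately show ?thesis by simp
  qed
qed simp

lemma isomorphism_class_eq_spectrum_class:
  assumes f: "f \<in> locally_constant 2 A"
  shows "isomorphism_class A (locally_constant 2 A) f = spectrum_class A (locally_constant 2 A) f"
proof -
  have "shift_isomorphic A (gibbs_measure A f) (gibbs_measure A g) \<longleftrightarrow>
      entropy_spectrum A (gibbs_measure A f) = entropy_spectrum A (gibbs_measure A g)"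
    if g: "g \<in> locally_constant 2 A" for g
  proof -
    obtain p where p: "0 < p" "p < 1" "gibbs_measure A f = markov_measure p"
      using gibbs_measure_markov[OF f] by blast
    obtain p' where p': "0 < p'" "p' < 1" "gibbs_measure A g = markov_measure p'"
      using gibbs_measure_markov[OF g] by blast
    show ?thesis
      using shift_isomorphic_markov_measure_iff[OF p(1,2) p'(1,2)]
        entropy_spectrum_markov_measure_iff[OF p(1,2) p'(1,2)] by (simp add: p(3) p'(3))
  qed
  then show ?thesis
    unfolding isomorphism_class_def spectrum_class_def by blast
qed

end

section \<open>The two matrices as instances\<close>

lemma golden_mean_shiftI:
  assumes dim: "dim_row A = 2" and ij: "{i, j} = {1, 2}" "i \<noteq> j"
    and entries: "A $$ (i - 1, i - 1) = 1" "A $$ (i - 1, j - 1) = 1" "A $$ (j - 1, i - 1) = 1" "A $$ (j - 1, j - 1) = 0"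
  shows "golden_mean_shift A i j"
proof
  have two: "{1..2} = {i, j}" unfolding ij by auto
  show "markov_shift A = {\<omega>. \<forall>n. \<omega> n \<in> {i, j} \<and> (\<omega> n = j \<longrightarrow> \<omega> (Suc n) = i)}"
    unfolding markov_shift_def dim two
  proof (intro Collect_cong iffI allI conjI impI)
    fix \<omega> :: "nat \<Rightarrow> nat" and n
    assume \<omega>: "\<forall>n. \<omega> n \<in> {i, j} \<and> A $$ (\<omega> n - 1, \<omega> (Suc n) - 1) = 1"
    then show "\<omega> n \<in> {i, j}" by blast
    assume "\<omega> n = j"
    moreover have "\<omega> (Suc n) \<in> {i, j}" "A $$ (\<omega> n - 1, \<omega> (Suc n) - 1) = 1"
      using \<omega> by blast+
    ultimately show "\<omega> (Suc n) = i" using entries(4) by auto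
  next
    fix \<omega> :: "nat \<Rightarrow> nat" and n
    assume \<omega>: "\<forall>n. \<omega> n \<in> {i, j} \<and> (\<omega> n = j \<longrightarrow> \<omega> (Suc n) = i)"
    then show "\<omega> n \<in> {i, j}" by blast
    have "\<omega> n \<in> {i, j}" "\<omega> (Suc n) \<in> {i, j}" "\<omega> n = j \<longrightarrow> \<omega> (Suc n) = i"
      using \<omega> by blast+
    then show "A $$ (\<omega> n - 1, \<omega> (Suc n) - 1) = 1" using entries by auto
  qed
qed (rule ij)

theorem corollary3p6:
  fixes A :: "nat mat" and \<C> :: "((nat \<Rightarrow> nat) \<Rightarrow> real) set"
  assumes "A = mat_of_rows_list 2 [[1, 1], [1, 0]] \<or> A = mat_of_rows_list 2 [[0, 1], [1, 1]]"
    and "\<C> = locally_constant 2 A"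
  shows "{f \<in> \<C>. isomorphism_class A \<C> f = spectrum_class A \<C> f} = \<C>"
proof -
  have "\<exists>i j. golden_mean_shift A i j"
    using assms(1)
  proof
    assume A: "A = mat_of_rows_list 2 [[1, 1], [1, 0]]"
    have "golden_mean_shift A 1 2"
      by (rule golden_mean_shiftI) (auto simp: A mat_of_rows_list_def)
    then show ?thesis by blast
  next
    assume A: "A = mat_of_rows_list 2 [[0, 1], [1, 1]]"
    have "golden_mean_shift A 2 1"
      by (rule golden_mean_shiftI) (auto simp: A mat_of_rows_list_def)
    then show ?thesis by blast
  qed
  then obtain i j where "golden_mean_shift A i j" by blast
  then show ?thesis
    using golden_mean_shift.isomorphism_class_eq_spectrum_class[of A i j] unfolding assms(2) by blast
qed

end
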